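(* Let $\gamma\in(0,1)$ and $d\in\mathbb N$. Then $\mathcal T^{\mathrm b}:=(A^{\mathrm b},T^{\mathrm b},\bar\Gamma^{\mathrm b}_{\mathscr B})$, where $\bar\Gamma^{\mathrm b}_{\mathscr B}:=\{\bar\Gamma^{\mathrm b}_g : g\in\mathscr B\}$, is a regularity structure, and $\langle\mathcal Y\rangle$ and $\langle\dot{\mathcal Y}\rangle$ are sectors of $\mathcal T^{\mathrm b}$.
   Context: Trees and forests: $\mathscr T_d$ is the set of (non-planar) rooted trees with nodes decorated by $\{1,\dots,d\}$, and $\mathscr F_d$ is the free commutative monoid on $\mathscr T_d$ (forests), with product $\odot$ and unit $\mathbf 1$ (the empty forest). For $\zeta\in\mathscr F_d$, $\lfloor\zeta\rfloor_i\in\mathscr T_d$ is the tree obtained by grafting all trees of $\zeta$ onto a new root with label $i$; every tree is uniquely of this form. $\#\zeta$ is the number of nodes of $\zeta$. $\langle M\rangle$ denotes the real vector space with basis $M$; $\odot$ is extended bilinearly and $\lfloor\cdot\rfloor_i$ linearly. The coproduct $\Delta_\star:\langle\mathscr F_d\rangle\to\langle\mathscr F_d\rangle\otimes\langle\mathscr F_d\rangle$ is the algebra homomorphism (for $\odot$) with $\Delta_\star\mathbf 1=\mathbf 1\otimes\mathbf 1$ and $\Delta_\star\lfloor\zeta\rfloor_i=\lfloor\zeta\rfloor_i\otimes\mathbf 1+(\mathrm{id}\otimes\lfloor\cdot\rfloor_i)\Delta_\star\zeta$. $\mathscr B$ is the group of characters of $(\langle\mathscr F_d\rangle,\odot)$,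 i.e. nonzero linear multiplicative maps $g:\langle\mathscr F_d\rangle\to\mathbb R$, under convolution $g*h=(g\otimes h)\Delta_\star$. Model space: $T^{\mathrm b}:=\langle\mathcal Y\rangle\oplus\langle\dot{\mathcal Y}\rangle$ with $\mathcal Y:=\mathscr T_d\cup\{\mathbf 1\}$ and $\dot{\mathcal Y}:=\bigcup_{i=1}^d\{\zeta\Xi_i:\zeta\in\mathscr F_d\}$, where $\Xi_1,\dots,\Xi_d$ are formal symbols ($\Xi_i:=\mathbf 1\Xi_i$). Homogeneities: $|\tau|=\gamma\,\#\tau$ for $\tau\in\mathcal Y$ (so $|\mathbf 1|=0$) and $|\zeta\Xi_i|=\gamma\,\#\zeta+\gamma-1$. Index set $A^{\mathrm b}:=\gamma\mathbb N_0\cup(\gamma\mathbb N-1)$, and for $\alpha\in A^{\mathrm b}$, $T^{\mathrm b}_\alpha$ is the (finite-dimensional) span of the basis symbols of homogeneity $\alpha$, with the Euclidean norm making these symbols orthonormal. Structure group: $\Delta^{\mathrm b}:T^{\mathrm b}\to\langle\mathscr F_d\rangle\otimes T^{\mathrm b}$ is linear with $\Delta^{\mathrm b}\tau=\Delta_\star\tau$ for $\tau\in\mathcal Y$ and $\Delta^{\mathrm b}(\zeta\Xi_i)=\sum\zeta_1\otimes\zeta_2\Xi_i$ where $\Delta_\star\zeta=\sum\zeta_1\otimes\zeta_2$. For linear $g:\langle\mathscr F_d\rangle\to\mathbb R$, $\bar\Gamma^{\mathrm b}_g:=(g\otimes\mathrm{id})\Delta^{\mathrm b}$. A regularity structure is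 a triple $(A,T,G)$ where: (1) $A\subseteq\mathbb R$ is bounded from below and $A\cap(-\infty,r)$ is finite for all $r\in\mathbb R$; (2) $T=\bigoplus_{\alpha\in A}T_\alpha$ with each $T_\alpha$ a non-trivial real Banach space with norm $\|\cdot\|_\alpha$, and $T$ is endowed with the norm $\|\cdot\|:=\sum_{\alpha\in A}\|\pi_\alpha\cdot\|_\alpha$, where $\pi_\alpha$ is the canonical projection onto $T_\alpha$; (3) $G\subseteq\mathcal L(T,T)$ is a group (under composition) of invertible linear operators on $T$ that are continuous for the norm $\|\cdot\|$, such that $\varGamma x-x\in T_{<\alpha}:=\bigoplus_{\beta\in A,\beta<\alpha}T_\beta$ for all $\varGamma\in G$, $\alpha\in A$, $x\in T_\alpha$. A sector of $(A,T,G)$ is a subspace $V\subseteq T$ such that $V\cap T_\alpha$ is a (possibly zero) closed subspace of $T_\alpha$ for each $\alpha\in A$ and $\varGamma V\subseteq V$ for all $\varGamma\in G$.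
   Formalization: Continuity of each operator in G is required only on every T_{<r} (r real), not on all of T: as stated the claim fails, since the character g with g(τ)=#τ on trees gives ‖τ‖=1 but ‖Γ_g τ‖ ≥ #τ, unbounded over trees. *)

theory Defs
  imports "HOL-Analysis.Analysis" "HOL-Analysis.Finite_Function_Topology"
begin

section \<open>Regularity structures\<close>

text \<open>
  The vector space \<open>T\<close> is the whole type \<^typ>\<open>'v\<close>; \<open>T \<alpha>\<close> are the homogeneous
  subspaces and \<open>N \<alpha>\<close> is the norm on \<open>T \<alpha>\<close> (its values off \<open>T \<alpha>\<close> are irrelevant).
\<close>

definition norm_on :: "'v::real_vector set \<Rightarrow> ('v \<Rightarrow> real) \<Rightarrow> bool" where
  "norm_on V n \<longleftrightarrow>
     (\<forall>x\<in>V. 0 \<le> n x \<and> (n x = 0 \<longleftrightarrow> x = 0)) \<and>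
     (\<forall>x\<in>V. \<forall>c. n (c *\<^sub>R x) = \<bar>c\<bar> * n x) \<and>
     (\<forall>x\<in>V. \<forall>y\<in>V. n (x + y) \<le> n x + n y)"

definition banach_on :: "'v::real_vector set \<Rightarrow> ('v \<Rightarrow> real) \<Rightarrow> bool" where
  "banach_on V n \<longleftrightarrow> subspace V \<and> norm_on V n \<and>
     (\<forall>X :: nat \<Rightarrow> 'v. (\<forall>k. X k \<in> V) \<and>
        (\<forall>e>0. \<exists>K. \<forall>k\<ge>K. \<forall>l\<ge>K. n (X k - X l) < e) \<longrightarrow>
        (\<exists>x\<in>V. (\<lambda>k. n (X k - x)) \<longlonglongrightarrow> 0))"

definition closed_in_norm :: "'v::real_vector set \<Rightarrow> ('v \<Rightarrow> real) \<Rightarrow> 'v set \<Rightarrow> bool" where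
  "closed_in_norm V n S \<longleftrightarrow> S \<subseteq> V \<and>
     (\<forall>x\<in>V. (\<forall>e>0. \<exists>y\<in>S. n (y - x) < e) \<longrightarrow> x \<in> S)"

definition continuous_in_norm :: "('v::real_vector \<Rightarrow> real) \<Rightarrow> 'v set \<Rightarrow> ('v \<Rightarrow> 'v) \<Rightarrow> bool" where
  "continuous_in_norm n S f \<longleftrightarrow>
     (\<forall>x\<in>S. \<forall>e>0. \<exists>\<delta>>0. \<forall>y\<in>S. n (y - x) < \<delta> \<longrightarrow> n (f y - f x) < e)"

definition graded_decomp ::
  "real set \<Rightarrow> (real \<Rightarrow> 'v::real_vector set) \<Rightarrow> 'v \<Rightarrow> (real \<Rightarrow> 'v) \<Rightarrow> bool" where
  "graded_decomp A T x f \<longleftrightarrow> finite {\<alpha>. f \<alpha> \<noteq> 0} \<and>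
     (\<forall>\<alpha>. f \<alpha> \<noteq> 0 \<longrightarrow> \<alpha> \<in> A \<and> f \<alpha> \<in> T \<alpha>) \<and> x = (\<Sum>\<alpha> | f \<alpha> \<noteq> 0. f \<alpha>)"

definition graded_proj :: "real set \<Rightarrow> (real \<Rightarrow> 'v::real_vector set) \<Rightarrow> real \<Rightarrow> 'v \<Rightarrow> 'v" where
  "graded_proj A T \<alpha> x = (THE f. graded_decomp A T x f) \<alpha>"

definition graded_norm ::
  "real set \<Rightarrow> (real \<Rightarrow> 'v::real_vector set) \<Rightarrow> (real \<Rightarrow> 'v \<Rightarrow> real) \<Rightarrow> 'v \<Rightarrow> real" where
  "graded_norm A T N x =
     (\<Sum>\<alpha> | \<alpha> \<in> A \<and> graded_proj A T \<alpha> x \<noteq> 0. N \<alpha> (graded_proj A T \<alpha> x))"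

definition graded_below :: "real set \<Rightarrow> (real \<Rightarrow> 'v::real_vector set) \<Rightarrow> real \<Rightarrow> 'v set" where
  "graded_below A T r = span (\<Union>\<beta>\<in>{\<beta>\<in>A. \<beta> < r}. T \<beta>)"

text \<open>
  Continuity for the norm \<^const>\<open>graded_norm\<close> is required on each
  \<open>T\<^sub><\<^sub>r = (\<Oplus>\<beta>\<in>A, \<beta><r. T\<^sub>\<beta>)\<close>, \<open>r \<in> \<real>\<close>. If \<open>A\<close> is bounded above this is continuity
  on all of \<open>T\<close>. For an infinite \<open>A\<close>, continuity on the full algebraic direct sum is a
  strictly stronger demand which the structure below does not satisfy, see lemma
  \<open>\<Gamma>_b_unbounded\<close> at the end of this theory.
\<close>

locale regularity_structure =
  fixes A :: "real set"
    and T :: "real \<Rightarrow> 'v::real_vector set"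
    and N :: "real \<Rightarrow> 'v \<Rightarrow> real"
    and G :: "('v \<Rightarrow> 'v) set"
  assumes bdd_below_A: "bdd_below A"
    and locally_finite_A: "finite (A \<inter> {..<r})"
    and banach_T: "\<alpha> \<in> A \<Longrightarrow> banach_on (T \<alpha>) (N \<alpha>)"
    and nontrivial_T: "\<alpha> \<in> A \<Longrightarrow> T \<alpha> \<noteq> {0}"
    and direct_sum: "\<exists>!f. graded_decomp A T x f"
    and linear_G: "\<Gamma> \<in> G \<Longrightarrow> linear \<Gamma>"
    and bij_G: "\<Gamma> \<in> G \<Longrightarrow> bij \<Gamma>"
    and continuous_G: "\<Gamma> \<in> G \<Longrightarrow> continuous_in_norm (graded_norm A T N) (graded_below A T r) \<Gamma>"
    and id_G: "id \<in> G"
    and comp_G: "\<Gamma> \<in> G \<Longrightarrow> \<Gamma>' \<in> G \<Longrightarrow> \<Gamma> \<circ> \<Gamma>' \<in> G"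
    and inv_G: "\<Gamma> \<in> G \<Longrightarrow> inv \<Gamma> \<in> G"
    and triangular_G: "\<Gamma> \<in> G \<Longrightarrow> \<alpha> \<in> A \<Longrightarrow> x \<in> T \<alpha> \<Longrightarrow> \<Gamma> x - x \<in> graded_below A T \<alpha>"

definition sector ::
  "real set \<Rightarrow> (real \<Rightarrow> 'v::real_vector set) \<Rightarrow> (real \<Rightarrow> 'v \<Rightarrow> real) \<Rightarrow> ('v \<Rightarrow> 'v) set \<Rightarrow> 'v set \<Rightarrow> bool"
where
  "sector A T N G V \<longleftrightarrow> subspace V \<and>
     (\<forall>\<alpha>\<in>A. subspace (V \<inter> T \<alpha>) \<and> closed_in_norm (T \<alpha>) (N \<alpha>) (V \<inter> T \<alpha>)) \<and>
     (\<forall>\<Gamma>\<in>G. \<Gamma> ` V \<subseteq> V)"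


section \<open>Free vector spaces\<close>

text \<open>
  \<open>\<langle>M\<rangle>\<close> is \<^typ>\<open>'m \<Rightarrow>\<^sub>0 real\<close>, for \<open>M\<close> the type \<^typ>\<open>'m\<close>, and \<open>\<langle>M\<rangle> \<otimes> \<langle>M'\<rangle>\<close> is identified
  with \<open>\<langle>M \<times> M'\<rangle>\<close>. If \<open>M\<close> is a commutative monoid, written additively, the product of
  \<^typ>\<open>'m \<Rightarrow>\<^sub>0 real\<close> is the bilinear extension of the monoid operation.
\<close>

definition bas :: "'m \<Rightarrow> ('m \<Rightarrow>\<^sub>0 real)" where
  "bas k = Poly_Mapping.single k 1"

definition lin_ext :: "('m \<Rightarrow> 'v::real_vector) \<Rightarrow> ('m \<Rightarrow>\<^sub>0 real) \<Rightarrow> 'v" where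
  "lin_ext f x = (\<Sum>k\<in>Poly_Mapping.keys x. Poly_Mapping.lookup x k *\<^sub>R f k)"

definition push :: "('m \<Rightarrow> 'n) \<Rightarrow> ('m \<Rightarrow>\<^sub>0 real) \<Rightarrow> ('n \<Rightarrow>\<^sub>0 real)" where
  "push f = lin_ext (\<lambda>k. bas (f k))"

definition free_span :: "'m set \<Rightarrow> ('m \<Rightarrow>\<^sub>0 real) set" where
  "free_span M = span (bas ` M)"

text \<open>The Euclidean norm for which the basis symbols are orthonormal.\<close>

definition euclidean_norm :: "('m \<Rightarrow>\<^sub>0 real) \<Rightarrow> real" where
  "euclidean_norm x = L2_set (Poly_Mapping.lookup x) (Poly_Mapping.keys x)"


section \<open>Trees, forests and characters\<close>

text \<open>
  Labels range over a finite type \<^typ>\<open>'d\<close>, whose cardinality is the number \<open>d \<ge> 1\<close>.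
  Forests are multisets of trees, so \<open>\<odot>\<close> is \<^term>\<open>(+)\<close> and the empty forest is \<^term>\<open>{#}\<close>.
\<close>

datatype 'd tree = Node 'd "'d tree multiset"

type_synonym 'd forest = "'d tree multiset"

primrec tree_nodes :: "'d tree \<Rightarrow> nat" where
  "tree_nodes (Node i \<zeta>) = Suc (sum_mset (image_mset tree_nodes \<zeta>))"

definition forest_nodes :: "'d forest \<Rightarrow> nat" where
  "forest_nodes \<zeta> = sum_mset (image_mset tree_nodes \<zeta>)"

text \<open>
  \<open>graft i\<close> is \<open>\<lfloor>\<cdot>\<rfloor>\<^sub>i\<close>. The recursive equation is
  \<open>\<Delta>\<^sub>\<star> \<lfloor>\<zeta>\<rfloor>\<^sub>i = \<lfloor>\<zeta>\<rfloor>\<^sub>i \<otimes> 1 + (id \<otimes> \<lfloor>\<cdot>\<rfloor>\<^sub>i) \<Delta>\<^sub>\<star> \<zeta>\<close>, with \<open>\<Delta>\<^sub>\<star> \<zeta>\<close> expanded as the product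
  of the \<open>\<Delta>\<^sub>\<star> t\<close> over the trees \<open>t\<close> of \<open>\<zeta>\<close>; see \<open>\<Delta>_star_graft\<close>, \<open>\<Delta>_star_mult\<close>.
\<close>

definition graft :: "'d \<Rightarrow> 'd forest \<Rightarrow> 'd forest" where
  "graft i \<zeta> = {#Node i \<zeta>#}"

primrec \<Delta>_tree :: "'d tree \<Rightarrow> ('d forest \<times> 'd forest \<Rightarrow>\<^sub>0 real)" where
  "\<Delta>_tree (Node i \<zeta>) = bas (graft i \<zeta>, {#})
     + push (apsnd (graft i)) (prod_mset (image_mset \<Delta>_tree \<zeta>))"

definition \<Delta>_star :: "('d forest \<Rightarrow>\<^sub>0 real) \<Rightarrow> ('d forest \<times> 'd forest \<Rightarrow>\<^sub>0 real)" where
  "\<Delta>_star = lin_ext (\<lambda>\<zeta>. prod_mset (image_mset \<Delta>_tree \<zeta>))"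

definition characters :: "(('d forest \<Rightarrow>\<^sub>0 real) \<Rightarrow> real) set" where
  "characters = {g. linear g \<and> (\<forall>x y. g (x * y) = g x * g y) \<and> g \<noteq> (\<lambda>_. 0)}"


section \<open>The model space and its structure group\<close>

text \<open>\<open>\<Y> = \<T>\<^sub>d \<union> {1}\<close>, with its inclusion into the forests.\<close>

datatype 'd ysym = YOne | YTree "'d tree"

primrec y_forest :: "'d ysym \<Rightarrow> 'd forest" where
  "y_forest YOne = {#}"
| "y_forest (YTree t) = {#t#}"

text \<open>The basis \<open>\<Y> \<union> \<dot>\<Y>\<close> of \<open>T\<^sup>b\<close>; \<open>Noise \<zeta> i\<close> is \<open>\<zeta> \<Xi>\<^sub>i\<close>.\<close>

datatype 'd symb = Y "'d ysym" | Noise "'d forest" 'd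

definition Y_symbols :: "'d symb set" where
  "Y_symbols = {Y \<tau> | \<tau>. True}"

definition Noise_symbols :: "'d symb set" where
  "Noise_symbols = {Noise \<zeta> i | \<zeta> i. True}"

primrec homogeneity :: "real \<Rightarrow> 'd symb \<Rightarrow> real" where
  "homogeneity \<gamma> (Y \<tau>) = \<gamma> * real (forest_nodes (y_forest \<tau>))"
| "homogeneity \<gamma> (Noise \<zeta> i) = \<gamma> * real (forest_nodes \<zeta>) + \<gamma> - 1"

definition A_b :: "real \<Rightarrow> real set" where
  "A_b \<gamma> = {\<gamma> * real n | n. True} \<union> {\<gamma> * real n - 1 | n. n \<ge> 1}"

definition T_b :: "real \<Rightarrow> real \<Rightarrow> ('d symb \<Rightarrow>\<^sub>0 real) set" where
  "T_b \<gamma> \<alpha> = free_span {s. homogeneity \<gamma> s = \<alpha>}"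

text \<open>
  \<open>\<Delta>\<^sub>\<star>\<close> maps \<open>\<langle>\<Y>\<rangle>\<close> into \<open>\<langle>\<F>\<^sub>d\<rangle> \<otimes> \<langle>\<Y>\<rangle>\<close> (lemma \<open>\<Delta>_b_Y\<close>), so \<^const>\<open>inv\<close> below is only ever
  applied to forests in the range of \<^const>\<open>y_forest\<close>.
\<close>

primrec \<Delta>_b_symb :: "'d symb \<Rightarrow> ('d forest \<times> 'd symb \<Rightarrow>\<^sub>0 real)" where
  "\<Delta>_b_symb (Y \<tau>) = push (apsnd (\<lambda>\<eta>. Y (inv y_forest \<eta>))) (\<Delta>_star (bas (y_forest \<tau>)))"
| "\<Delta>_b_symb (Noise \<zeta> i) = push (apsnd (\<lambda>\<eta>. Noise \<eta> i)) (\<Delta>_star (bas \<zeta>))"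

definition \<Delta>_b :: "('d symb \<Rightarrow>\<^sub>0 real) \<Rightarrow> ('d forest \<times> 'd symb \<Rightarrow>\<^sub>0 real)" where
  "\<Delta>_b = lin_ext \<Delta>_b_symb"

definition \<Gamma>_b :: "(('d forest \<Rightarrow>\<^sub>0 real) \<Rightarrow> real) \<Rightarrow> ('d symb \<Rightarrow>\<^sub>0 real) \<Rightarrow> ('d symb \<Rightarrow>\<^sub>0 real)" where
  "\<Gamma>_b g x = lin_ext (\<lambda>(\<zeta>, s). g (bas \<zeta>) *\<^sub>R bas s) (\<Delta>_b x)"


section \<open>Consistency of the definitions\<close>

lemma lookup_scaleR [simp]: "Poly_Mapping.lookup (c *\<^sub>R x) k = c *\<^sub>R Poly_Mapping.lookup x k"
proof -
  have "finite {i. c *\<^sub>R Poly_Mapping.lookup x i \<noteq> 0}"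
    by (rule finite_subset[of _ "Poly_Mapping.keys x"]) (auto simp: in_keys_iff)
  then show ?thesis by (simp add: scaleR_poly_mapping_def)
qed

lemma lin_ext_superset:
  assumes "finite S" "Poly_Mapping.keys x \<subseteq> S"
  shows "lin_ext f x = (\<Sum>k\<in>S. Poly_Mapping.lookup x k *\<^sub>R f k)"
  unfolding lin_ext_def by (rule sum.mono_neutral_left) (use assms in \<open>auto simp: in_keys_iff\<close>)

lemma linear_lin_ext: "linear (lin_ext f)"
proof (rule linearI)
  fix x y :: "'a \<Rightarrow>\<^sub>0 real" and c :: real
  let ?S = "Poly_Mapping.keys x \<union> Poly_Mapping.keys y"
  show "lin_ext f (x + y) = lin_ext f x + lin_ext f y"
    using lin_ext_superset[of ?S "x + y" f] lin_ext_superset[of ?S x f]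
      lin_ext_superset[of ?S y f] keys_add[of x y]
    by (simp add: lookup_add scaleR_add_left sum.distrib)
  have "Poly_Mapping.keys (c *\<^sub>R x) \<subseteq> Poly_Mapping.keys x" by (auto simp: in_keys_iff)
  then show "lin_ext f (c *\<^sub>R x) = c *\<^sub>R lin_ext f x"
    using lin_ext_superset[of "Poly_Mapping.keys x" "c *\<^sub>R x" f]
    by (simp add: lin_ext_def scaleR_sum_right)
qed

lemma lin_ext_bas [simp]: "lin_ext f (bas k) = f k"
  by (simp add: lin_ext_def bas_def)

lemma lookup_bas: "Poly_Mapping.lookup (bas k) l = (if k = l then 1 else 0)"
  by (simp add: bas_def lookup_single)

lemma bas_expansion: "x = lin_ext bas x"
proof (rule poly_mapping_eqI)
  fix k
  show "Poly_Mapping.lookup x k = Poly_Mapping.lookup (lin_ext bas x) k"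
    by (auto simp: lin_ext_def lookup_sum lookup_bas if_distrib in_keys_iff cong: if_cong)
qed

lemma linear_eq_on_bas:
  assumes "linear f" "linear g" "\<And>k. f (bas k) = g (bas k)"
  shows "f x = g x"
proof -
  have "f (lin_ext bas x) = g (lin_ext bas x)"
    by (simp add: lin_ext_def linear_sum[OF assms(1)] linear_sum[OF assms(2)]
        linear_scale[OF assms(1)] linear_scale[OF assms(2)] assms(3))
  then show ?thesis by (simp flip: bas_expansion)
qed

lemma scaleR_eq_single_mult: "c *\<^sub>R x = Poly_Mapping.single 0 c * (x :: 'm::comm_monoid_add \<Rightarrow>\<^sub>0 real)"
proof -
  have "c *\<^sub>R x = Poly_Mapping.map ((*) c) x"
    by (rule poly_mapping_eqI) (simp add: Poly_Mapping.map.rep_eq when_def)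
  then show ?thesis by (simp add: mult_map_scale_conv_mult)
qed

lemma linear_mult_left: "linear (\<lambda>y. x * y :: 'm::comm_monoid_add \<Rightarrow>\<^sub>0 real)"
  by (rule linearI) (simp_all add: distrib_left scaleR_eq_single_mult mult.left_commute)

lemma linear_mult_right: "linear (\<lambda>x. x * y :: 'm::comm_monoid_add \<Rightarrow>\<^sub>0 real)"
  using linear_mult_left[of y] by (simp add: mult.commute)

lemma bas_mult: "bas k * bas l = bas (k + l)"
  by (simp add: bas_def mult_single)

lemma mult_eq_on_bas:
  fixes f :: "('m::comm_monoid_add \<Rightarrow>\<^sub>0 real) \<Rightarrow> 'v::real_vector"
  assumes "linear f" "\<And>y. linear (\<lambda>x. h x y)" "\<And>x. linear (h x)"
    "\<And>k l. f (bas (k + l)) = h (bas k) (bas l)"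
  shows "f (x * y) = h x y"
proof -
  have left: "linear (\<lambda>y. f (a * y))" and right: "linear (\<lambda>a. f (a * y))" for a y
    using linear_compose[OF linear_mult_left assms(1)] linear_compose[OF linear_mult_right assms(1)]
    by (simp_all only: o_def)
  have "f (bas k * y) = h (bas k) y" for k
    by (rule linear_eq_on_bas[OF left assms(3)]) (simp only: bas_mult assms(4))
  then show ?thesis
    by (rule linear_eq_on_bas[OF right assms(2)])
qed

lemma linear_\<Delta>_star: "linear \<Delta>_star"
  unfolding \<Delta>_star_def by (rule linear_lin_ext)

lemma \<Delta>_star_one: "\<Delta>_star (bas {#}) = bas ({#}, {#})"
  by (simp add: \<Delta>_star_def) (simp add: bas_def flip: single_one zero_prod_def)

lemma \<Delta>_star_mult: "\<Delta>_star (x * y) = \<Delta>_star x * \<Delta>_star y"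
proof (rule mult_eq_on_bas[where h = "\<lambda>x y. \<Delta>_star x * \<Delta>_star y"])
  show "linear (\<lambda>x. \<Delta>_star x * \<Delta>_star y)" for y
    using linear_compose[OF linear_\<Delta>_star linear_mult_right] by (simp add: o_def)
  show "linear (\<lambda>y. \<Delta>_star x * \<Delta>_star y)" for x
    using linear_compose[OF linear_\<Delta>_star linear_mult_left] by (simp add: o_def)
  show "\<Delta>_star (bas (k + l)) = \<Delta>_star (bas k) * \<Delta>_star (bas l)" for k l
    by (simp add: \<Delta>_star_def)
qed (rule linear_\<Delta>_star)

lemma \<Delta>_star_graft:
  "\<Delta>_star (bas (graft i \<zeta>)) =
     bas (graft i \<zeta>, {#}) + push (apsnd (graft i)) (\<Delta>_star (bas \<zeta>))"
  by (simp add: \<Delta>_star_def graft_def)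

lemma inj_y_forest: "inj y_forest"
proof (rule injI)
  fix a b :: "'d ysym" assume "y_forest a = y_forest b"
  then show "a = b" by (cases a; cases b) auto
qed

lemma push_bas [simp]: "push f (bas k) = bas (f k)"
  by (simp add: push_def)

lemma linear_push: "linear (push f)"
  by (simp add: push_def linear_lin_ext)

lemma push_push: "push f (push h x) = push (f \<circ> h) x"
  using linear_eq_on_bas[OF linear_compose[OF linear_push[of h] linear_push[of f]] linear_push[of "f \<circ> h"]]
  by (simp add: o_def)

lemma \<Delta>_b_Y:
  fixes \<tau> :: "'d ysym"
  shows "\<exists>D. push (apsnd y_forest) D = \<Delta>_star (bas (y_forest \<tau>)) \<and>
       \<Delta>_b (bas (Y \<tau>)) = push (apsnd Y) D"
proof -
  obtain D where D: "push (apsnd y_forest) D = \<Delta>_star (bas (y_forest \<tau>))"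
  proof (cases \<tau>)
    case YOne
    show thesis
      by (rule that[of "bas ({#}, YOne)"]) (simp add: YOne \<Delta>_star_one)
  next
    case (YTree t)
    obtain i \<zeta> where t: "t = Node i \<zeta>" by (cases t)
    have *: "apsnd y_forest \<circ> apsnd (\<lambda>\<eta>. YTree (Node i \<eta>)) = apsnd (graft i)"
      by (auto simp: fun_eq_iff graft_def)
    show thesis
      by (rule that[of "bas (graft i \<zeta>, YOne) + push (apsnd (\<lambda>\<eta>. YTree (Node i \<eta>))) (\<Delta>_star (bas \<zeta>))"])
         (use \<Delta>_star_graft[of i \<zeta>] in
           \<open>simp add: YTree t linear_add[OF linear_push] push_push * graft_def\<close>)
  qed
  have "apsnd (\<lambda>\<eta>. Y (inv y_forest \<eta>)) \<circ> apsnd y_forest =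
      (apsnd Y :: 'd forest \<times> 'd ysym \<Rightarrow> _)"
    by (auto simp: fun_eq_iff inv_f_f[OF inj_y_forest])
  with D show ?thesis
    by (intro exI[of _ D]) (simp only: \<Delta>_b_def lin_ext_bas \<Delta>_b_symb.simps push_push simp_thms flip: D)
qed


section \<open>Unboundedness on the full direct sum\<close>

text \<open>
  Some \<open>\<Gamma>\<^sub>g\<close>, \<open>g \<in> \<B>\<close>, maps symbols, which have norm \<open>1\<close>, to vectors with arbitrarily large
  coefficients. The norm \<^const>\<open>graded_norm\<close> dominates every coefficient, so this \<open>\<Gamma>\<^sub>g\<close>
  is not continuous on all of \<open>T\<^sup>b\<close>.
\<close>

lemma character_exists:
  "\<exists>g\<in>characters. \<forall>t. g (bas {#t#}) = f t"
proof -
  define g where "g = lin_ext (\<lambda>\<zeta>. prod_mset (image_mset f \<zeta>) :: real)"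
  have lin: "linear g" unfolding g_def by (rule linear_lin_ext)
  have gb: "g (bas \<zeta>) = prod_mset (image_mset f \<zeta>)" for \<zeta> by (simp add: g_def)
  have "g (x * y) = g x * g y" for x y
  proof (rule mult_eq_on_bas[where h = "\<lambda>x y. g x * g y", OF lin])
    show "linear (\<lambda>x. g x * g y)" for y
      by (rule linearI) (simp_all add: linear_add[OF lin] linear_scale[OF lin] algebra_simps)
    show "linear (\<lambda>y. g x * g y)" for x
      by (rule linearI) (simp_all add: linear_add[OF lin] linear_scale[OF lin] algebra_simps)
  qed (simp add: gb)
  moreover have "g \<noteq> (\<lambda>_. 0)"
    using gb[of "{#}"] by (metis image_mset_empty prod_mset_empty zero_neq_one)
  ultimately have "g \<in> characters" using lin by (simp add: characters_def)
  then show ?thesis using gb by (intro bexI[of _ g]) auto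
qed

lemma \<Gamma>_b_coeff_YOne:
  assumes "linear g"
  shows "Poly_Mapping.lookup (\<Gamma>_b g (bas (Y (YTree t)))) (Y YOne) = g (bas {#t#})"
proof -
  obtain i \<zeta> where t: "t = Node i \<zeta>" by (cases t)
  have inv1: "inv y_forest {#} = YOne" and inv2: "inv y_forest {#s#} = YTree s" for s :: "'a tree"
    using inv_f_f[OF inj_y_forest, of YOne] inv_f_f[OF inj_y_forest, of "YTree s"] by simp_all
  let ?h = "\<lambda>(\<zeta>, s). g (bas \<zeta>) *\<^sub>R bas s"
  have "\<Delta>_b (bas (Y (YTree t))) = bas (graft i \<zeta>, Y YOne) +
      push (apsnd (\<lambda>\<eta>. Y (inv y_forest \<eta>)) \<circ> apsnd (graft i)) (\<Delta>_star (bas \<zeta>))"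
    using \<Delta>_star_graft[of i \<zeta>]
    by (simp add: \<Delta>_b_def t graft_def[symmetric] linear_add[OF linear_push] push_push inv1)
  also have "apsnd (\<lambda>\<eta>. Y (inv y_forest \<eta>)) \<circ> apsnd (graft i) =
      (apsnd (\<lambda>\<eta>. Y (YTree (Node i \<eta>))) :: 'a forest \<times> 'a forest \<Rightarrow> _)"
    by (auto simp: fun_eq_iff graft_def inv2)
  finally have \<Gamma>: "\<Gamma>_b g (bas (Y (YTree t))) = g (bas {#t#}) *\<^sub>R bas (Y YOne) +
      lin_ext ?h (push (apsnd (\<lambda>\<eta>. Y (YTree (Node i \<eta>)))) (\<Delta>_star (bas \<zeta>)))"
    by (simp add: \<Gamma>_b_def linear_add[OF linear_lin_ext] t graft_def)
  have push: "lin_ext ?h (push f D) = lin_ext (?h \<circ> f) D"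
    for f and D :: "'a forest \<times> 'a forest \<Rightarrow>\<^sub>0 real"
    using linear_eq_on_bas[OF linear_compose[OF linear_push[of f] linear_lin_ext[of ?h]]
        linear_lin_ext[of "?h \<circ> f"]]
    by (simp add: o_def)
  show ?thesis
    unfolding \<Gamma> push by (simp add: lookup_add lookup_bas lin_ext_def lookup_sum case_prod_unfold)
qed

lemma ex_tree_nodes: "\<exists>t :: 'd tree. tree_nodes t = Suc n"
proof (induction n)
  case 0
  show ?case by (rule exI[of _ "Node undefined {#}"]) simp
next
  case (Suc n)
  then obtain t :: "'d tree" where "tree_nodes t = Suc n" by blast
  then show ?case by (intro exI[of _ "Node undefined {#t#}"]) simp
qed

lemma \<Gamma>_b_unbounded:
  "\<exists>g\<in>characters. \<forall>C. \<exists>t :: 'd tree.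
     C < Poly_Mapping.lookup (\<Gamma>_b g (bas (Y (YTree t)))) (Y YOne)"
proof -
  obtain g where g: "g \<in> characters" "\<And>t :: 'd tree. g (bas {#t#}) = real (tree_nodes t)"
    using character_exists[of "\<lambda>t :: 'd tree. real (tree_nodes t)"] by auto
  have "\<exists>t :: 'd tree. C < g (bas {#t#})" for C
  proof -
    obtain n where "C < real n" using reals_Archimedean2 by blast
    moreover obtain t :: "'d tree" where "tree_nodes t = Suc n" using ex_tree_nodes by blast
    ultimately show ?thesis by (intro exI[of _ t]) (simp add: g(2))
  qed
  then show ?thesis
    using g(1) \<Gamma>_b_coeff_YOne[of g] by (intro bexI[of _ g]) (auto simp: characters_def)
qed

end

theory Submission
  imports Defs
begin

text \<open>
  The algebra of the proof takes place on forests. For a character \<open>g\<close> the operator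
  \<open>F\<^sub>g = (g \<otimes> id) \<Delta>\<^sub>\<star>\<close> (\<open>forest_op\<close>) is the unital algebra endomorphism determined by
  \<open>F\<^sub>g \<lfloor>\<zeta>\<rfloor>\<^sub>i = g \<lfloor>\<zeta>\<rfloor>\<^sub>i 1 + \<lfloor>F\<^sub>g \<zeta>\<rfloor>\<^sub>i\<close>. This recursion takes the place of coassociativity:
  \<open>F\<^sub>g \<circ> F\<^sub>h\<close> and \<open>F\<^bsub>g \<circ> F\<^sub>h\<^esub>\<close> are multiplicative and satisfy the same recursion, so they agree
  (\<open>forest_op_compose\<close>). Here \<open>g \<circ> F\<^sub>h\<close> is again a character, the convolution \<open>h * g\<close>. The recursion
  also yields inverses without an antipode: to get \<open>g \<circ> F\<^sub>h = \<epsilon>\<close>, with \<open>\<epsilon>\<close> the counit, one needs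
  \<open>h \<lfloor>\<zeta>\<rfloor>\<^sub>i = - g \<lfloor>F\<^sub>h \<zeta>\<rfloor>\<^sub>i\<close>, whose right-hand side involves \<open>h\<close> only on trees strictly inside
  \<open>\<lfloor>\<zeta>\<rfloor>\<^sub>i\<close> (\<open>character_right_inverse\<close>). Finally \<open>F\<^sub>g \<zeta> - \<zeta>\<close> is a combination of forests with fewer
  nodes than \<open>\<zeta>\<close> (\<open>forest_op_lower\<close>).

  On the model space, \<open>\<Gamma>\<^sub>g (\<zeta> \<Xi>\<^sub>i) = (F\<^sub>g \<zeta>) \<Xi>\<^sub>i\<close>, and \<open>\<Gamma>\<^sub>g\<close> acts on \<open>\<Y>\<close> as \<open>F\<^sub>g\<close> does on trees and \<open>1\<close>.
  Hence the operators \<open>\<Gamma>\<^sub>g\<close> form a group, change a symbol only by terms of lower homogeneity, and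
  preserve both sectors.

  The analytic conditions hold because finitely many symbols lie below a given homogeneity: the
  spaces \<open>T\<^sub>\<alpha>\<close> and \<open>T\<^sub><\<^sub>r\<close> are finite-dimensional, so the former are complete and linear maps on the
  latter are bounded. Boundedness is first shown for the sum of the absolute values of the
  coefficients, and then transferred to the graded norm, which is equivalent to it on \<open>T\<^sub><\<^sub>r\<close>.
\<close>

section \<open>Coordinate subspaces of a free vector space\<close>

lemma free_span_iff_keys: "x \<in> free_span M \<longleftrightarrow> Poly_Mapping.keys x \<subseteq> M"
proof
  have "subspace {x :: 'a \<Rightarrow>\<^sub>0 real. Poly_Mapping.keys x \<subseteq> M}"
  proof (rule subspaceI)
    fix x y :: "'a \<Rightarrow>\<^sub>0 real"
    assume "x \<in> {x. Poly_Mapping.keys x \<subseteq> M}" "y \<in> {x. Poly_Mapping.keys x \<subseteq> M}"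
    then show "x + y \<in> {x. Poly_Mapping.keys x \<subseteq> M}"
      using keys_add[of x y] by auto
  qed (auto simp: in_keys_iff)
  moreover have "bas ` M \<subseteq> {x. Poly_Mapping.keys x \<subseteq> M}"
    by (auto simp: bas_def)
  ultimately show "x \<in> free_span M \<Longrightarrow> Poly_Mapping.keys x \<subseteq> M"
    unfolding free_span_def using span_minimal by blast
next
  assume "Poly_Mapping.keys x \<subseteq> M"
  then have "lin_ext bas x \<in> free_span M"
    unfolding lin_ext_def free_span_def
    by (intro span_sum span_scale span_base) auto
  then show "x \<in> free_span M" by (simp flip: bas_expansion)
qed

lemma subspace_free_span: "subspace (free_span M)"
  by (simp add: free_span_def subspace_span)

lemma free_span_Int: "free_span M \<inter> free_span M' = free_span (M \<inter> M')"
  by (auto simp: free_span_iff_keys)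

lemma free_span_mono: "M \<subseteq> M' \<Longrightarrow> free_span M \<subseteq> free_span M'"
  by (auto simp: free_span_iff_keys)

lemma bas_in_free_span: "k \<in> M \<Longrightarrow> bas k \<in> free_span M"
  by (simp add: free_span_def span_base)

lemma bas_nonzero: "bas k \<noteq> 0"
  by (metis lookup_bas lookup_zero zero_neq_one)

lemma lin_ext_in_subspace:
  assumes "subspace W" "\<And>k. k \<in> Poly_Mapping.keys x \<Longrightarrow> f k \<in> W"
  shows "lin_ext f x \<in> W"
  unfolding lin_ext_def using assms by (intro subspace_sum subspace_scale) auto

lemma lin_ext_in_free_span:
  assumes "x \<in> free_span M" "\<And>k. k \<in> M \<Longrightarrow> f k \<in> free_span M'"
  shows "lin_ext f x \<in> free_span M'"
  using assms by (intro lin_ext_in_subspace subspace_free_span) (auto simp: free_span_iff_keys)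

lemma push_in_free_span:
  assumes "x \<in> free_span M" "\<And>k. k \<in> M \<Longrightarrow> f k \<in> M'"
  shows "push f x \<in> free_span M'"
  unfolding push_def using assms by (intro lin_ext_in_free_span bas_in_free_span)

lemma mult_in_free_span:
  fixes x y :: "'m::comm_monoid_add \<Rightarrow>\<^sub>0 real"
  assumes "x \<in> free_span M" "y \<in> free_span M'" "\<And>k l. k \<in> M \<Longrightarrow> l \<in> M' \<Longrightarrow> k + l \<in> M''"
  shows "x * y \<in> free_span M''"
  using assms keys_mult[of x y] unfolding free_span_iff_keys by blast

section \<open>The Euclidean norm and the sum of the coefficients\<close>

lemma euclidean_norm_superset:
  assumes "finite S" "Poly_Mapping.keys x \<subseteq> S"
  shows "euclidean_norm x = L2_set (Poly_Mapping.lookup x) S"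
  unfolding euclidean_norm_def L2_set_def
  by (intro arg_cong[where f = sqrt] sum.mono_neutral_left)
     (use assms in \<open>auto simp: in_keys_iff\<close>)

lemma abs_lookup_le_euclidean_norm: "\<bar>Poly_Mapping.lookup x k\<bar> \<le> euclidean_norm x"
proof (cases "k \<in> Poly_Mapping.keys x")
  case True
  then have "\<bar>Poly_Mapping.lookup x k\<bar> \<le> L2_set (\<lambda>k. \<bar>Poly_Mapping.lookup x k\<bar>) (Poly_Mapping.keys x)"
    by (intro member_le_L2_set) auto
  then show ?thesis by (simp add: euclidean_norm_def L2_set_def)
qed (auto simp: in_keys_iff euclidean_norm_def)

lemma norm_on_euclidean_norm: "norm_on V euclidean_norm"
  unfolding norm_on_def
proof (intro conjI ballI allI)
  fix x y :: "'a \<Rightarrow>\<^sub>0 real" and c :: real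
  show "0 \<le> euclidean_norm x" by (simp add: euclidean_norm_def)
  show "euclidean_norm x = 0 \<longleftrightarrow> x = 0"
  proof
    assume "euclidean_norm x = 0"
    then have "Poly_Mapping.lookup x k = 0" for k
      using abs_lookup_le_euclidean_norm[of x k] by simp
    then show "x = 0" by (intro poly_mapping_eqI) simp
  qed (simp add: euclidean_norm_def)
  have "Poly_Mapping.keys (c *\<^sub>R x) \<subseteq> Poly_Mapping.keys x" by (auto simp: in_keys_iff)
  then show "euclidean_norm (c *\<^sub>R x) = \<bar>c\<bar> * euclidean_norm x"
    using euclidean_norm_superset[of "Poly_Mapping.keys x" "c *\<^sub>R x"]
    by (simp add: euclidean_norm_def L2_set_def power_mult_distrib real_sqrt_mult
        flip: sum_distrib_left)
  let ?S = "Poly_Mapping.keys x \<union> Poly_Mapping.keys y"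
  show "euclidean_norm (x + y) \<le> euclidean_norm x + euclidean_norm y"
    using euclidean_norm_superset[of ?S "x + y"] euclidean_norm_superset[of ?S x]
      euclidean_norm_superset[of ?S y] keys_add[of x y]
      L2_set_triangle_ineq[of "Poly_Mapping.lookup x" "Poly_Mapping.lookup y" ?S]
    by (simp add: plus_poly_mapping.rep_eq)
qed

text \<open>
  A Cauchy sequence is Cauchy in each coordinate; as there are finitely many coordinates, the
  vector of coordinatewise limits is a limit in norm.
\<close>

lemma banach_on_free_span:
  assumes "finite M"
  shows "banach_on (free_span M) euclidean_norm"
  unfolding banach_on_def
proof (intro conjI allI impI subspace_free_span norm_on_euclidean_norm, elim conjE)
  fix X :: "nat \<Rightarrow> 'a \<Rightarrow>\<^sub>0 real"
  assume X: "\<forall>k. X k \<in> free_span M"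
    and C: "\<forall>e>0. \<exists>K. \<forall>k\<ge>K. \<forall>l\<ge>K. euclidean_norm (X k - X l) < e"
  have "Cauchy (\<lambda>i. Poly_Mapping.lookup (X i) m)" for m
  proof (rule CauchyI)
    fix e :: real assume "0 < e"
    then obtain K where "\<forall>k\<ge>K. \<forall>l\<ge>K. euclidean_norm (X k - X l) < e" using C by blast
    moreover have "norm (Poly_Mapping.lookup (X k) m - Poly_Mapping.lookup (X l) m)
        \<le> euclidean_norm (X k - X l)" for k l
      using abs_lookup_le_euclidean_norm[of "X k - X l" m] by (simp add: lookup_minus)
    ultimately show "\<exists>K. \<forall>k\<ge>K. \<forall>l\<ge>K.
        norm (Poly_Mapping.lookup (X k) m - Poly_Mapping.lookup (X l) m) < e"
      by (meson le_less_trans)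
  qed
  then obtain L where L: "(\<lambda>i. Poly_Mapping.lookup (X i) m) \<longlonglongrightarrow> L m" for m
    unfolding Cauchy_convergent_iff convergent_def by metis
  define x where "x = (\<Sum>m\<in>M. L m *\<^sub>R bas m)"
  have x: "x \<in> free_span M"
    unfolding x_def by (intro subspace_sum subspace_scale subspace_free_span bas_in_free_span)
  have lx: "Poly_Mapping.lookup x m = L m" if "m \<in> M" for m
    using assms that by (simp add: x_def lookup_sum lookup_bas if_distrib cong: if_cong)
  have "Poly_Mapping.keys (X i - x) \<subseteq> M" for i
    using subspace_diff[OF subspace_free_span, of "X i" M x] X x by (simp add: free_span_iff_keys)
  then have "euclidean_norm (X i - x) = sqrt (\<Sum>m\<in>M. (Poly_Mapping.lookup (X i) m - L m)\<^sup>2)" for i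
    by (simp add: euclidean_norm_superset[OF assms] L2_set_def lookup_minus lx)
  moreover have "(\<lambda>i. sqrt (\<Sum>m\<in>M. (Poly_Mapping.lookup (X i) m - L m)\<^sup>2)) \<longlonglongrightarrow>
      sqrt (\<Sum>m\<in>M. (L m - L m)\<^sup>2)"
    by (intro tendsto_intros L)
  ultimately have "(\<lambda>i. euclidean_norm (X i - x)) \<longlonglongrightarrow> 0" by simp
  with x show "\<exists>x\<in>free_span M. (\<lambda>k. euclidean_norm (X k - x)) \<longlonglongrightarrow> 0" by blast
qed

text \<open>
  A coordinate that vanishes on the subspace is bounded on the limit by the distance to the
  subspace, hence vanishes there too.
\<close>

lemma closed_in_norm_free_span:
  "closed_in_norm (free_span M) euclidean_norm (free_span M' \<inter> free_span M)"
  unfolding closed_in_norm_def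
proof (intro conjI ballI impI)
  fix x assume x: "x \<in> free_span M"
    and lim: "\<forall>e>0. \<exists>y\<in>free_span M' \<inter> free_span M. euclidean_norm (y - x) < e"
  have "Poly_Mapping.lookup x k = 0" if "k \<notin> M'" for k
  proof (rule ccontr)
    assume "Poly_Mapping.lookup x k \<noteq> 0"
    then obtain y where y: "y \<in> free_span M'" "euclidean_norm (y - x) < \<bar>Poly_Mapping.lookup x k\<bar>"
      using lim by (metis IntD1 zero_less_abs_iff)
    then have "Poly_Mapping.lookup y k = 0"
      using that by (auto simp: free_span_iff_keys in_keys_iff)
    then show False
      using y(2) abs_lookup_le_euclidean_norm[of "y - x" k] by (simp add: lookup_minus)
  qed
  then show "x \<in> free_span M' \<inter> free_span M"
    using x by (auto simp: free_span_iff_keys in_keys_iff)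
qed auto

definition coeff_sum :: "('m \<Rightarrow>\<^sub>0 real) \<Rightarrow> real" where
  "coeff_sum x = (\<Sum>k\<in>Poly_Mapping.keys x. \<bar>Poly_Mapping.lookup x k\<bar>)"

lemma coeff_sum_superset:
  assumes "finite S" "Poly_Mapping.keys x \<subseteq> S"
  shows "coeff_sum x = (\<Sum>k\<in>S. \<bar>Poly_Mapping.lookup x k\<bar>)"
  unfolding coeff_sum_def by (rule sum.mono_neutral_left) (use assms in \<open>auto simp: in_keys_iff\<close>)

lemma coeff_sum_add_le: "coeff_sum (x + y) \<le> coeff_sum x + coeff_sum y"
proof -
  let ?S = "Poly_Mapping.keys x \<union> Poly_Mapping.keys y"
  show ?thesis
    using coeff_sum_superset[of ?S "x + y"] coeff_sum_superset[of ?S x]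
      coeff_sum_superset[of ?S y] keys_add[of x y]
    by (simp add: lookup_add sum_mono flip: sum.distrib)
qed

lemma coeff_sum_scaleR: "coeff_sum (c *\<^sub>R x) = \<bar>c\<bar> * coeff_sum x"
proof -
  have "Poly_Mapping.keys (c *\<^sub>R x) \<subseteq> Poly_Mapping.keys x" by (auto simp: in_keys_iff)
  then show ?thesis
    using coeff_sum_superset[of "Poly_Mapping.keys x" "c *\<^sub>R x"]
    by (simp add: coeff_sum_def abs_mult sum_distrib_left)
qed

lemma coeff_sum_sum_le: "coeff_sum (sum f S) \<le> (\<Sum>k\<in>S. coeff_sum (f k))"
proof (induction S rule: infinite_finite_induct)
  case (insert k S)
  then show ?case using coeff_sum_add_le[of "f k" "sum f S"] by simp
qed (simp_all add: coeff_sum_def)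

lemma linear_bounded_on_free_span:
  fixes \<Gamma> :: "('m \<Rightarrow>\<^sub>0 real) \<Rightarrow> ('n \<Rightarrow>\<^sub>0 real)"
  assumes "linear \<Gamma>" "finite S"
  shows "\<exists>C\<ge>0. \<forall>x\<in>free_span S. coeff_sum (\<Gamma> x) \<le> C * coeff_sum x"
proof (intro exI conjI ballI)
  let ?C = "\<Sum>k\<in>S. coeff_sum (\<Gamma> (bas k))"
  have nonneg: "0 \<le> coeff_sum z" for z :: "'n \<Rightarrow>\<^sub>0 real" by (simp add: coeff_sum_def sum_nonneg)
  then show "0 \<le> ?C" by (intro sum_nonneg)
  fix x assume "x \<in> free_span S"
  then have S: "Poly_Mapping.keys x \<subseteq> S" by (simp add: free_span_iff_keys)
  have "\<Gamma> x = \<Gamma> (lin_ext bas x)" by (simp flip: bas_expansion)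
  also have "\<dots> = (\<Sum>k\<in>S. Poly_Mapping.lookup x k *\<^sub>R \<Gamma> (bas k))"
    by (simp add: lin_ext_superset[OF assms(2) S] linear_sum[OF assms(1)] linear_scale[OF assms(1)])
  finally have "coeff_sum (\<Gamma> x) \<le> (\<Sum>k\<in>S. \<bar>Poly_Mapping.lookup x k\<bar> * coeff_sum (\<Gamma> (bas k)))"
    using coeff_sum_sum_le[of "\<lambda>k. Poly_Mapping.lookup x k *\<^sub>R \<Gamma> (bas k)" S]
    by (simp add: coeff_sum_scaleR)
  also have "\<dots> \<le> (\<Sum>k\<in>S. \<bar>Poly_Mapping.lookup x k\<bar> * ?C)"
    using assms(2) nonneg by (intro sum_mono mult_left_mono member_le_sum) auto
  also have "\<dots> = ?C * coeff_sum x"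
    by (simp only: coeff_sum_superset[OF assms(2) S] mult.commute[of ?C] flip: sum_distrib_right)
  finally show "coeff_sum (\<Gamma> x) \<le> ?C * coeff_sum x" .
qed

section \<open>Free vector spaces on a graded basis\<close>

text \<open>
  The spaces \<open>T \<alpha>\<close> below are spanned by the basis elements of degree \<open>\<alpha>\<close>. Different shapes of symbols may
  share a degree, as happens for the homogeneity when \<open>1 / \<gamma>\<close> is an integer, so
  the grading is kept as an arbitrary function on the basis.
\<close>

locale graded_basis =
  fixes A :: "real set" and deg :: "'m \<Rightarrow> real"
  assumes deg_in: "deg k \<in> A"
    and finite_below: "finite {k. deg k < r}"
begin

definition T :: "real \<Rightarrow> ('m \<Rightarrow>\<^sub>0 real) set" where
  "T \<alpha> = free_span {k. deg k = \<alpha>}"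

definition component :: "('m \<Rightarrow>\<^sub>0 real) \<Rightarrow> real \<Rightarrow> ('m \<Rightarrow>\<^sub>0 real)" where
  "component x \<alpha> = lin_ext (\<lambda>k. if deg k = \<alpha> then bas k else 0) x"

lemma lookup_component:
  "Poly_Mapping.lookup (component x \<alpha>) k = (if deg k = \<alpha> then Poly_Mapping.lookup x k else 0)"
proof -
  have "Poly_Mapping.lookup (component x \<alpha>) k =
      (\<Sum>l\<in>Poly_Mapping.keys x. if l = k then (if deg k = \<alpha> then Poly_Mapping.lookup x k else 0) else 0)"
    unfolding component_def lin_ext_def lookup_sum
    by (intro sum.cong) (auto simp: lookup_bas)
  then show ?thesis by (simp add: in_keys_iff)
qed

lemma keys_component: "Poly_Mapping.keys (component x \<alpha>) = {k \<in> Poly_Mapping.keys x. deg k = \<alpha>}"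
  by (auto simp: in_keys_iff lookup_component split: if_splits)

lemma component_nonzero_iff: "component x \<alpha> \<noteq> 0 \<longleftrightarrow> \<alpha> \<in> deg ` Poly_Mapping.keys x"
proof -
  have "component x \<alpha> \<noteq> 0 \<longleftrightarrow> Poly_Mapping.keys (component x \<alpha>) \<noteq> {}" by simp
  then show ?thesis unfolding keys_component by blast
qed

text \<open>
  Evaluating a decomposition \<open>x = (\<Sum>\<alpha>. f \<alpha>)\<close> at the basis element \<open>k\<close> leaves the single summand
  \<open>\<alpha> = deg k\<close>, which forces \<open>f\<close> to be the family of homogeneous parts of \<open>x\<close>. This gives existence and
  uniqueness at once.
\<close>

lemma graded_decomp_iff: "graded_decomp A T x f \<longleftrightarrow> f = component x"
proof
  assume f: "graded_decomp A T x f"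
  then have fin: "finite {\<alpha>. f \<alpha> \<noteq> 0}" and x: "x = (\<Sum>\<alpha> | f \<alpha> \<noteq> 0. f \<alpha>)"
    by (simp_all add: graded_decomp_def)
  have off: "Poly_Mapping.lookup (f \<beta>) k = 0" if "deg k \<noteq> \<beta>" for \<beta> k
  proof (cases "f \<beta> = 0")
    case False
    then have "Poly_Mapping.keys (f \<beta>) \<subseteq> {k. deg k = \<beta>}"
      using f by (simp add: graded_decomp_def T_def free_span_iff_keys)
    then show ?thesis using that by (auto simp: in_keys_iff)
  qed simp
  have diag: "Poly_Mapping.lookup x k = Poly_Mapping.lookup (f (deg k)) k" for k
  proof -
    have "Poly_Mapping.lookup x k = (\<Sum>\<alpha> | f \<alpha> \<noteq> 0. Poly_Mapping.lookup (f \<alpha>) k)"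
      by (subst x) (simp add: lookup_sum)
    also have "\<dots> = (\<Sum>\<alpha> | f \<alpha> \<noteq> 0. if \<alpha> = deg k then Poly_Mapping.lookup (f (deg k)) k else 0)"
      by (intro sum.cong) (auto simp: off)
    finally show ?thesis using fin by auto
  qed
  show "f = component x"
    by (intro ext poly_mapping_eqI) (auto simp: lookup_component diag off)
next
  assume f: "f = component x"
  have supp: "{\<alpha>. component x \<alpha> \<noteq> 0} = deg ` Poly_Mapping.keys x"
    by (auto simp: component_nonzero_iff)
  have "x = (\<Sum>\<alpha>\<in>deg ` Poly_Mapping.keys x. component x \<alpha>)"
    by (rule poly_mapping_eqI) (auto simp: lookup_sum lookup_component in_keys_iff)
  moreover have "component x \<alpha> \<in> T \<alpha>" for \<alpha>
    by (auto simp: T_def free_span_iff_keys keys_component)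
  ultimately show "graded_decomp A T x f"
    unfolding f graded_decomp_def supp using deg_in by (auto simp: component_nonzero_iff)
qed

lemma graded_proj_eq: "graded_proj A T \<alpha> x = component x \<alpha>"
  by (simp add: graded_proj_def graded_decomp_iff)

lemma graded_norm_eq:
  "graded_norm A T (\<lambda>_. euclidean_norm) x =
     (\<Sum>\<alpha>\<in>deg ` Poly_Mapping.keys x. euclidean_norm (component x \<alpha>))"
  unfolding graded_norm_def graded_proj_eq component_nonzero_iff
  by (intro sum.cong) (auto simp: deg_in)

lemma graded_norm_le_coeff_sum: "graded_norm A T (\<lambda>_. euclidean_norm) x \<le> coeff_sum x"
proof -
  have "euclidean_norm (component x \<alpha>) \<le>
      (\<Sum>k | k \<in> Poly_Mapping.keys x \<and> deg k = \<alpha>. \<bar>Poly_Mapping.lookup x k\<bar>)" for \<alpha>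
    using L2_set_le_sum_abs[of "Poly_Mapping.lookup (component x \<alpha>)" "Poly_Mapping.keys (component x \<alpha>)"]
    by (simp add: euclidean_norm_def keys_component lookup_component)
  then show ?thesis
    unfolding graded_norm_eq coeff_sum_def
      sum.image_gen[OF finite_keys, of "\<lambda>k. \<bar>Poly_Mapping.lookup x k\<bar>" x deg]
    by (intro sum_mono)
qed

lemma abs_lookup_le_graded_norm:
  "\<bar>Poly_Mapping.lookup x k\<bar> \<le> graded_norm A T (\<lambda>_. euclidean_norm) x"
proof (cases "k \<in> Poly_Mapping.keys x")
  case True
  have "\<bar>Poly_Mapping.lookup x k\<bar> \<le> euclidean_norm (component x (deg k))"
    using abs_lookup_le_euclidean_norm[of "component x (deg k)" k] by (simp add: lookup_component)
  also have "\<dots> \<le> graded_norm A T (\<lambda>_. euclidean_norm) x"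
    unfolding graded_norm_eq using True
    by (intro member_le_sum) (auto simp: euclidean_norm_def)
  finally show ?thesis .
next
  case False
  then show ?thesis
    by (simp add: graded_norm_eq in_keys_iff) (simp add: euclidean_norm_def sum_nonneg)
qed

text \<open>
  Together with \<open>graded_norm_le_coeff_sum\<close> this is the equivalence of the two norms on a
  finite-dimensional coordinate subspace.
\<close>

lemma coeff_sum_le_graded_norm:
  assumes "finite S" "x \<in> free_span S"
  shows "coeff_sum x \<le> card S * graded_norm A T (\<lambda>_. euclidean_norm) x"
proof -
  have "coeff_sum x = (\<Sum>k\<in>S. \<bar>Poly_Mapping.lookup x k\<bar>)"
    using assms by (simp add: coeff_sum_superset free_span_iff_keys)
  also have "\<dots> \<le> of_nat (card S) * graded_norm A T (\<lambda>_. euclidean_norm) x"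
    by (intro sum_bounded_above abs_lookup_le_graded_norm)
  finally show ?thesis .
qed

lemma graded_below_eq: "graded_below A T r = free_span {k. deg k < r}"
proof
  have "T \<beta> \<subseteq> free_span {k. deg k < r}" if "\<beta> < r" for \<beta>
    unfolding T_def using that by (intro free_span_mono) auto
  then show "graded_below A T r \<subseteq> free_span {k. deg k < r}"
    unfolding graded_below_def by (intro span_minimal subspace_free_span) auto
  have "bas k \<in> graded_below A T r" if "deg k < r" for k
    unfolding graded_below_def T_def using that deg_in[of k]
    by (intro span_base) (auto intro: bas_in_free_span)
  then show "free_span {k. deg k < r} \<subseteq> graded_below A T r"
    unfolding free_span_def graded_below_def by (intro span_minimal subspace_span) auto
qed

lemma triangular_on_T:
  assumes "linear \<Gamma>" "\<And>k. \<Gamma> (bas k) - bas k \<in> free_span {l. deg l < deg k}" "x \<in> T \<alpha>"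
  shows "\<Gamma> x - x \<in> graded_below A T \<alpha>"
proof -
  have "linear (\<lambda>x. \<Gamma> x - x)" by (intro linear_compose_sub assms(1) linear_ident)
  then have "\<Gamma> x - x = lin_ext (\<lambda>k. \<Gamma> (bas k) - bas k) x"
    by (rule linear_eq_on_bas[OF _ linear_lin_ext]) simp
  also have "\<dots> \<in> free_span {l. deg l < \<alpha>}"
    by (rule lin_ext_in_free_span[OF assms(3)[unfolded T_def]]) (use assms(2) in auto)
  finally show ?thesis by (simp add: graded_below_eq)
qed

lemma continuous_on_below:
  assumes lin: "linear \<Gamma>"
    and tri: "\<And>k. \<Gamma> (bas k) - bas k \<in> free_span {l. deg l < deg k}"
  shows "continuous_in_norm (graded_norm A T (\<lambda>_. euclidean_norm)) (graded_below A T r) \<Gamma>"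
proof -
  let ?n = "graded_norm A T (\<lambda>_. euclidean_norm)" and ?S = "{k. deg k < r}"
  obtain C where C: "0 \<le> C" "\<And>x. x \<in> free_span ?S \<Longrightarrow> coeff_sum (\<Gamma> x) \<le> C * coeff_sum x"
    using linear_bounded_on_free_span[OF lin finite_below] by blast
  \<comment> \<open>The summand \<open>1\<close> makes \<open>D\<close> positive, so that \<open>e / D\<close> can serve as the modulus of continuity.\<close>
  define D where "D = C * card ?S + 1"
  have "0 < D" using C(1) by (simp add: D_def add_nonneg_pos)
  have bound: "?n (\<Gamma> x) \<le> D * ?n x" if "x \<in> free_span ?S" for x
  proof -
    have "0 \<le> ?n x" using abs_lookup_le_graded_norm[of x] by (meson abs_ge_zero order_trans)
    have "?n (\<Gamma> x) \<le> C * coeff_sum x"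
      using graded_norm_le_coeff_sum[of "\<Gamma> x"] C(2)[OF that] by simp
    also have "\<dots> \<le> C * (card ?S * ?n x)"
      by (intro mult_left_mono coeff_sum_le_graded_norm finite_below that C(1))
    also have "\<dots> \<le> D * ?n x" using \<open>0 \<le> ?n x\<close> by (simp add: D_def algebra_simps)
    finally show ?thesis .
  qed
  show ?thesis
    unfolding continuous_in_norm_def graded_below_eq
  proof (intro ballI allI impI)
    fix x and e :: real assume x: "x \<in> free_span ?S" and "0 < e"
    have "?n (\<Gamma> y - \<Gamma> x) < e" if "y \<in> free_span ?S" "?n (y - x) < e / D" for y
      using bound[OF subspace_diff[OF subspace_free_span that(1) x]] that(2) \<open>0 < D\<close>
      by (simp add: linear_diff[OF lin] field_simps)
    then show "\<exists>\<delta>>0. \<forall>y\<in>free_span ?S. ?n (y - x) < \<delta> \<longrightarrow> ?n (\<Gamma> y - \<Gamma> x) < e"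
      using \<open>0 < e\<close> \<open>0 < D\<close> by (intro exI[of _ "e / D"]) simp
  qed
qed

lemma banach_on_T: "banach_on (T \<alpha>) euclidean_norm"
  unfolding T_def
  by (intro banach_on_free_span finite_subset[OF _ finite_below[of "\<alpha> + 1"]]) auto

lemma sector_free_span:
  assumes "\<And>\<Gamma>. \<Gamma> \<in> G \<Longrightarrow> linear \<Gamma>"
    and "\<And>\<Gamma> k. \<Gamma> \<in> G \<Longrightarrow> k \<in> M \<Longrightarrow> \<Gamma> (bas k) \<in> free_span M"
  shows "sector A T (\<lambda>_. euclidean_norm) G (free_span M)"
  unfolding sector_def
proof (intro conjI ballI subspace_free_span)
  fix \<alpha>
  show "subspace (free_span M \<inter> T \<alpha>)"
    by (simp add: T_def free_span_Int subspace_free_span)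
  show "closed_in_norm (T \<alpha>) euclidean_norm (free_span M \<inter> T \<alpha>)"
    unfolding T_def by (rule closed_in_norm_free_span)
next
  fix \<Gamma> assume \<Gamma>: "\<Gamma> \<in> G"
  show "\<Gamma> ` free_span M \<subseteq> free_span M"
  proof (rule image_subsetI)
    fix x assume x: "x \<in> free_span M"
    have "\<Gamma> x = lin_ext (\<lambda>k. \<Gamma> (bas k)) x"
      by (rule linear_eq_on_bas[OF assms(1)[OF \<Gamma>] linear_lin_ext]) simp
    also have "\<dots> \<in> free_span M"
      by (rule lin_ext_in_free_span[OF x assms(2)[OF \<Gamma>]])
    finally show "\<Gamma> x \<in> free_span M" .
  qed
qed

end

section \<open>Characters acting on forests\<close>

lemma bas_empty_forest: "bas ({#} :: 'a multiset) = 1"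
  by (simp add: bas_def flip: single_one)

lemma character_linear: "g \<in> characters \<Longrightarrow> linear g"
  and character_mult: "g \<in> characters \<Longrightarrow> g (x * y) = g x * g y"
  by (simp_all add: characters_def)

lemma character_one: "g \<in> characters \<Longrightarrow> g 1 = 1"
proof -
  assume g: "g \<in> characters"
  then obtain x where "g x \<noteq> 0" unfolding characters_def by blast
  then show "g 1 = 1" using character_mult[OF g, of x 1] by simp
qed

lemma multiplicative_bas:
  fixes F :: "('a multiset \<Rightarrow>\<^sub>0 real) \<Rightarrow> 'b::comm_monoid_mult"
  assumes "F 1 = 1" "\<And>x y. F (x * y) = F x * F y"
  shows "F (bas \<zeta>) = prod_mset (image_mset (\<lambda>t. F (bas {#t#})) \<zeta>)"
proof (induction \<zeta>)
  case empty
  show ?case by (simp add: bas_empty_forest assms(1))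
next
  case (add t \<zeta>)
  have "bas (add_mset t \<zeta>) = bas {#t#} * bas \<zeta>" by (simp add: bas_mult)
  then show ?case by (simp add: assms(2) add.IH)
qed

text \<open>
  The map \<open>g \<otimes> id\<close> on \<open>\<langle>\<F>\<^sub>d\<rangle> \<otimes> \<langle>S\<rangle>\<close>, for an arbitrary set of symbols \<open>S\<close>: it is used for forests as well as
  for the symbols of the model space.
\<close>

definition slice ::
  "(('d forest \<Rightarrow>\<^sub>0 real) \<Rightarrow> real) \<Rightarrow> ('d forest \<times> 's \<Rightarrow>\<^sub>0 real) \<Rightarrow> ('s \<Rightarrow>\<^sub>0 real)" where
  "slice g = lin_ext (\<lambda>(\<zeta>, s). g (bas \<zeta>) *\<^sub>R bas s)"

lemma linear_slice: "linear (slice g)"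
  by (simp add: slice_def linear_lin_ext)

lemma slice_bas: "slice g (bas (\<zeta>, s)) = g (bas \<zeta>) *\<^sub>R bas s"
  by (simp add: slice_def)

lemma slice_push: "slice g (push (apsnd f) D) = push f (slice g D)"
proof (rule linear_eq_on_bas[of "\<lambda>D. slice g (push (apsnd f) D)" "\<lambda>D. push f (slice g D)"])
  show "linear (\<lambda>D. slice g (push (apsnd f) D))" "linear (\<lambda>D. push f (slice g D))"
    using linear_compose[OF linear_push linear_slice] linear_compose[OF linear_slice linear_push]
    by (simp_all add: o_def)
  show "slice g (push (apsnd f) (bas k)) = push f (slice g (bas k))" for k
    by (cases k) (simp add: slice_bas linear_scale[OF linear_push])
qed

lemma slice_mult:
  fixes D E :: "'d forest \<times> 'd forest \<Rightarrow>\<^sub>0 real"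
  assumes "g \<in> characters"
  shows "slice g (D * E) = slice g D * slice g E"
proof (rule mult_eq_on_bas[where h = "\<lambda>D E. slice g D * slice g E", OF linear_slice])
  show "linear (\<lambda>D. slice g D * slice g E)" "linear (\<lambda>E. slice g D * slice g E)"
    for D E :: "'d forest \<times> 'd forest \<Rightarrow>\<^sub>0 real"
    using linear_compose[OF linear_slice linear_mult_right]
      linear_compose[OF linear_slice linear_mult_left] by (simp_all add: o_def)
  show "slice g (bas (k + l)) = slice g (bas k) * slice g (bas l)"
    for k l :: "'d forest \<times> 'd forest"
    by (cases k; cases l)
       (simp add: slice_bas character_mult[OF assms] scaleR_eq_single_mult mult_single
          ac_simps flip: bas_mult)
qed

definition forest_op :: "(('d forest \<Rightarrow>\<^sub>0 real) \<Rightarrow> real) \<Rightarrow> ('d forest \<Rightarrow>\<^sub>0 real) \<Rightarrow> ('d forest \<Rightarrow>\<^sub>0 real)"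
  where "forest_op g x = slice g (\<Delta>_star x)"

lemma linear_forest_op: "linear (forest_op g)"
  using linear_compose[OF linear_\<Delta>_star linear_slice] by (simp add: o_def forest_op_def[abs_def])

lemma forest_op_mult: "g \<in> characters \<Longrightarrow> forest_op g (x * y) = forest_op g x * forest_op g y"
  by (simp add: forest_op_def \<Delta>_star_mult slice_mult)

lemma forest_op_one: "g \<in> characters \<Longrightarrow> forest_op g 1 = 1"
  by (simp add: forest_op_def \<Delta>_star_one slice_bas character_one flip: bas_empty_forest)
     (simp add: bas_empty_forest character_one)

lemma forest_op_graft:
  "forest_op g (bas (graft i \<zeta>)) =
     g (bas (graft i \<zeta>)) *\<^sub>R 1 + push (graft i) (forest_op g (bas \<zeta>))"
  by (simp add: forest_op_def \<Delta>_star_graft linear_add[OF linear_slice] slice_bas slice_push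
      bas_empty_forest)

lemma forest_op_push_graft:
  "forest_op g (push (graft i) x) = g (push (graft i) x) *\<^sub>R 1 + push (graft i) (forest_op g x)"
  if "linear g"
proof -
  have rhs: "linear (\<lambda>x. g (push (graft i) x) *\<^sub>R (1 :: 'a forest \<Rightarrow>\<^sub>0 real) + push (graft i) (forest_op g x))"
    by (rule linearI)
       (simp_all add: linear_add[OF linear_push] linear_add[OF that] linear_add[OF linear_forest_op]
         linear_scale[OF linear_push] linear_scale[OF that] linear_scale[OF linear_forest_op]
         algebra_simps)
  have lhs: "linear (\<lambda>x. forest_op g (push (graft i) x))"
    using linear_compose[OF linear_push linear_forest_op] by (simp add: o_def)
  show ?thesis
    by (rule linear_eq_on_bas[OF lhs rhs]) (simp add: forest_op_graft)
qed

text \<open>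
  Induction on trees: a multiplicative map is determined on \<open>\<zeta>\<close> by its values on the trees of \<open>\<zeta>\<close>, so
  two such maps agree as soon as agreement passes from \<open>\<zeta>\<close> to \<open>\<lfloor>\<zeta>\<rfloor>\<^sub>i\<close>.
\<close>

lemma multiplicative_eq_on_trees:
  fixes F F' :: "('d forest \<Rightarrow>\<^sub>0 real) \<Rightarrow> 'b::{real_vector,comm_monoid_mult}"
  assumes "linear F" "F 1 = 1" "\<And>x y. F (x * y) = F x * F y"
    and "linear F'" "F' 1 = 1" "\<And>x y. F' (x * y) = F' x * F' y"
    and graft: "\<And>i \<zeta>. F (bas \<zeta>) = F' (bas \<zeta>) \<Longrightarrow> F (bas (graft i \<zeta>)) = F' (bas (graft i \<zeta>))"
  shows "F = F'"
proof
  have step: "F (bas \<zeta>) = F' (bas \<zeta>)"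
    if "\<And>t. t \<in># \<zeta> \<Longrightarrow> F (bas {#t#}) = F' (bas {#t#})" for \<zeta>
  proof -
    have "F (bas \<zeta>) = prod_mset (image_mset (\<lambda>t. F (bas {#t#})) \<zeta>)"
      by (rule multiplicative_bas[OF assms(2,3)])
    also have "image_mset (\<lambda>t. F (bas {#t#})) \<zeta> = image_mset (\<lambda>t. F' (bas {#t#})) \<zeta>"
      by (rule image_mset_cong) (rule that)
    also have "prod_mset \<dots> = F' (bas \<zeta>)"
      by (rule multiplicative_bas[OF assms(5,6), symmetric])
    finally show ?thesis .
  qed
  have tree: "F (bas {#t#}) = F' (bas {#t#})" for t
  proof (induction t)
    case (Node i \<zeta>)
    then have "F (bas \<zeta>) = F' (bas \<zeta>)" by (rule step)
    then show ?case by (rule graft[unfolded graft_def])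
  qed
  show "F x = F' x" for x by (rule linear_eq_on_bas[OF assms(1,4) step[OF tree]])
qed

lemma character_forest_op:
  assumes g: "g \<in> characters" and h: "h \<in> characters"
  shows "g \<circ> forest_op h \<in> characters"
proof -
  have "(g \<circ> forest_op h) 1 = 1" by (simp add: forest_op_one[OF h] character_one[OF g])
  then have "g \<circ> forest_op h \<noteq> (\<lambda>_. 0)" by (metis zero_neq_one)
  then show ?thesis
    using linear_compose[OF linear_forest_op character_linear[OF g]]
    by (simp add: characters_def forest_op_mult[OF h] character_mult[OF g])
qed

text \<open>
  With \<open>k = g \<circ> F\<^sub>h\<close>, applying \<open>F\<^sub>g\<close> to \<open>F\<^sub>h \<lfloor>\<zeta>\<rfloor>\<^sub>i = h \<lfloor>\<zeta>\<rfloor>\<^sub>i 1 + \<lfloor>F\<^sub>h \<zeta>\<rfloor>\<^sub>i\<close> gives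
  \<open>(h \<lfloor>\<zeta>\<rfloor>\<^sub>i + g \<lfloor>F\<^sub>h \<zeta>\<rfloor>\<^sub>i) 1 + \<lfloor>F\<^sub>g F\<^sub>h \<zeta>\<rfloor>\<^sub>i\<close>, and the coefficient of \<open>1\<close> is \<open>k \<lfloor>\<zeta>\<rfloor>\<^sub>i\<close>. So the composition obeys
  the recursion for \<open>F\<^sub>k\<close>.
\<close>

lemma forest_op_compose:
  assumes g: "g \<in> characters" and h: "h \<in> characters"
  shows "forest_op g \<circ> forest_op h = forest_op (g \<circ> forest_op h)"
proof (rule multiplicative_eq_on_trees)
  note gh = character_forest_op[OF g h]
  show "linear (forest_op g \<circ> forest_op h)" by (intro linear_compose linear_forest_op)
  show "linear (forest_op (g \<circ> forest_op h))" by (rule linear_forest_op)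
  fix i and \<zeta> :: "'a forest"
  assume "(forest_op g \<circ> forest_op h) (bas \<zeta>) = forest_op (g \<circ> forest_op h) (bas \<zeta>)"
  then show "(forest_op g \<circ> forest_op h) (bas (graft i \<zeta>)) =
      forest_op (g \<circ> forest_op h) (bas (graft i \<zeta>))"
    using character_linear[OF g] character_one[OF g] forest_op_one[OF g]
    by (simp add: forest_op_graft linear_add[OF linear_forest_op] linear_scale[OF linear_forest_op]
        forest_op_push_graft linear_add linear_scale algebra_simps)
qed (simp_all add: forest_op_one[OF g] forest_op_one[OF h] forest_op_mult[OF g] forest_op_mult[OF h]
      forest_op_one[OF character_forest_op[OF g h]] forest_op_mult[OF character_forest_op[OF g h]])

text \<open>
  For the right inverse \<open>h\<close> of \<open>g\<close> this is \<open>F\<^sub>h\<close> on trees, written without reference to \<open>h\<close>: the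
  scalar \<open>h \<lfloor>\<zeta>\<rfloor>\<^sub>i\<close> is replaced by the only value for which \<open>g\<close> annihilates the result. The recursion is
  structural because \<open>F\<^sub>h \<zeta>\<close> is the product over the trees of \<open>\<zeta>\<close>.
\<close>

primrec subtracted_tree :: "(('d forest \<Rightarrow>\<^sub>0 real) \<Rightarrow> real) \<Rightarrow> 'd tree \<Rightarrow> ('d forest \<Rightarrow>\<^sub>0 real)" where
  "subtracted_tree g (Node i \<zeta>) =
     push (graft i) (prod_mset (image_mset (subtracted_tree g) \<zeta>))
     - g (push (graft i) (prod_mset (image_mset (subtracted_tree g) \<zeta>))) *\<^sub>R 1"

definition counit :: "('d forest \<Rightarrow>\<^sub>0 real) \<Rightarrow> real" where
  "counit x = Poly_Mapping.lookup x {#}"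

lemma character_counit: "counit \<in> characters"
proof -
  have lin: "linear counit" by (rule linearI) (simp_all add: counit_def lookup_add)
  have "counit (x * y) = counit x * counit y" for x y :: "'a forest \<Rightarrow>\<^sub>0 real"
  proof (rule mult_eq_on_bas[where h = "\<lambda>x y. counit x * counit y", OF lin])
    show "linear (\<lambda>x. counit x * counit y)" "linear (\<lambda>y. counit x * counit y)"
      for x y :: "'a forest \<Rightarrow>\<^sub>0 real"
      by (rule linearI, simp_all add: linear_add[OF lin] linear_scale[OF lin] algebra_simps)+
  qed (auto simp: counit_def lookup_bas)
  moreover have "counit \<noteq> (\<lambda>_. 0)"
    by (metis counit_def lookup_bas zero_neq_one)
  ultimately show ?thesis using lin by (simp add: characters_def)
qed

lemma counit_graft: "counit (bas (graft i \<zeta>)) = 0"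
  by (simp add: counit_def lookup_bas graft_def)

lemma forest_op_counit: "forest_op counit = id"
  by (rule multiplicative_eq_on_trees)
     (simp_all add: linear_forest_op forest_op_one character_counit forest_op_mult linear_id
       forest_op_graft counit_graft)

text \<open>
  The character \<open>h\<close> may be prescribed freely on trees. Choosing the subtracted scalars as
  its values makes \<open>F\<^sub>h\<close> equal to \<open>subtracted_tree g\<close> on trees, and \<open>g\<close> vanishes there by construction, as
  the counit does.
\<close>

lemma character_right_inverse:
  assumes g: "g \<in> characters"
  shows "\<exists>h\<in>characters. g \<circ> forest_op h = counit"
proof -
  define R where "R \<zeta> = prod_mset (image_mset (subtracted_tree g) \<zeta>)" for \<zeta>
  define f where "f t = (case t of Node i \<zeta> \<Rightarrow> - g (push (graft i) (R \<zeta>)))" for t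
  obtain h where h: "h \<in> characters" and hf: "\<And>t. h (bas {#t#}) = f t"
    using character_exists[of f] by blast
  have forest: "forest_op h (bas \<zeta>) = R \<zeta>"
    if "\<And>t. t \<in># \<zeta> \<Longrightarrow> forest_op h (bas {#t#}) = subtracted_tree g t" for \<zeta>
  proof -
    have "forest_op h (bas \<zeta>) = prod_mset (image_mset (\<lambda>t. forest_op h (bas {#t#})) \<zeta>)"
      by (rule multiplicative_bas[where F = "forest_op h", OF forest_op_one[OF h] forest_op_mult[OF h]])
    also have "image_mset (\<lambda>t. forest_op h (bas {#t#})) \<zeta> = image_mset (subtracted_tree g) \<zeta>"
      by (rule image_mset_cong) (rule that)
    finally show ?thesis by (simp only: R_def)
  qed
  have tree: "forest_op h (bas {#t#}) = subtracted_tree g t" for t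
  proof (induction t)
    case (Node i \<zeta>)
    then have R: "forest_op h (bas \<zeta>) = R \<zeta>" by (rule forest)
    have "h (bas (graft i \<zeta>)) = - g (push (graft i) (R \<zeta>))"
      by (simp add: graft_def hf f_def)
    then have "forest_op h (bas (graft i \<zeta>)) = subtracted_tree g (Node i \<zeta>)"
      by (simp add: forest_op_graft R) (simp add: R_def)
    then show ?case by (simp only: graft_def)
  qed
  have "g \<circ> forest_op h = counit"
  proof (rule multiplicative_eq_on_trees)
    fix i \<zeta>
    have "(g \<circ> forest_op h) (bas (graft i \<zeta>)) = g (subtracted_tree g (Node i \<zeta>))"
      by (simp add: graft_def tree)
    also have "\<dots> = 0"
      by (simp add: linear_diff[OF character_linear[OF g]] linear_scale[OF character_linear[OF g]]
          character_one[OF g])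
    finally show "(g \<circ> forest_op h) (bas (graft i \<zeta>)) = counit (bas (graft i \<zeta>))"
      by (simp add: counit_graft)
  qed (simp_all add: character_forest_op[OF g h] character_counit character_linear character_one
      character_mult del: o_apply)
  with h show ?thesis by blast
qed

section \<open>Lower order terms\<close>

lemma forest_nodes_empty: "forest_nodes {#} = 0"
  by (simp add: forest_nodes_def)

lemma forest_nodes_add: "forest_nodes (\<zeta> + \<eta>) = forest_nodes \<zeta> + forest_nodes \<eta>"
  by (simp add: forest_nodes_def)

lemma forest_nodes_graft: "forest_nodes (graft i \<zeta>) = Suc (forest_nodes \<zeta>)"
  by (simp add: forest_nodes_def graft_def)

definition lower :: "nat \<Rightarrow> ('d forest \<Rightarrow>\<^sub>0 real) set" where
  "lower n = free_span {\<eta>. forest_nodes \<eta> < n}"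

lemma lower_push_graft: "x \<in> lower n \<Longrightarrow> push (graft i) x \<in> lower (Suc n)"
  unfolding lower_def by (rule push_in_free_span) (auto simp: forest_nodes_graft)

lemma forest_op_lower_mult:
  assumes g: "g \<in> characters"
    and x: "forest_op g (bas \<zeta>) - bas \<zeta> \<in> lower (forest_nodes \<zeta>)"
    and y: "forest_op g (bas \<eta>) - bas \<eta> \<in> lower (forest_nodes \<eta>)"
  shows "forest_op g (bas (\<zeta> + \<eta>)) - bas (\<zeta> + \<eta>) \<in> lower (forest_nodes (\<zeta> + \<eta>))"
proof -
  let ?a = "forest_op g (bas \<zeta>) - bas \<zeta>" and ?b = "forest_op g (bas \<eta>) - bas \<eta>"
  have "forest_op g (bas (\<zeta> + \<eta>)) - bas (\<zeta> + \<eta>) = bas \<zeta> * ?b + ?a * bas \<eta> + ?a * ?b"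
    by (simp add: forest_op_mult[OF g] algebra_simps flip: bas_mult)
  moreover have z: "bas \<zeta> \<in> free_span {\<zeta>}" "bas \<eta> \<in> free_span {\<eta>}"
    by (simp_all add: bas_in_free_span)
  have "bas \<zeta> * ?b \<in> lower (forest_nodes (\<zeta> + \<eta>))"
    using mult_in_free_span[OF z(1) y[unfolded lower_def]] unfolding lower_def
    by (simp add: forest_nodes_add)
  moreover have "?a * bas \<eta> \<in> lower (forest_nodes (\<zeta> + \<eta>))"
    using mult_in_free_span[OF x[unfolded lower_def] z(2)] unfolding lower_def
    by (simp add: forest_nodes_add)
  moreover have "?a * ?b \<in> lower (forest_nodes (\<zeta> + \<eta>))"
    using mult_in_free_span[OF x[unfolded lower_def] y[unfolded lower_def]] unfolding lower_def
    by (simp add: forest_nodes_add)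
  ultimately show ?thesis
    unfolding lower_def by (simp add: subspace_add[OF subspace_free_span])
qed

text \<open>
  On \<open>\<lfloor>\<zeta>\<rfloor>\<^sub>i\<close> the difference is \<open>g \<lfloor>\<zeta>\<rfloor>\<^sub>i 1\<close>, without nodes, plus the grafted difference for \<open>\<zeta>\<close>. Products
  are covered by \<open>forest_op_lower_mult\<close>: in \<open>(\<zeta> + a)(\<eta> + b) - \<zeta> \<eta>\<close> every term has a factor of lower order.
\<close>

lemma forest_op_lower:
  assumes g: "g \<in> characters"
  shows "forest_op g (bas \<zeta>) - bas \<zeta> \<in> lower (forest_nodes \<zeta>)"
proof -
  let ?P = "\<lambda>\<zeta>. forest_op g (bas \<zeta>) - bas \<zeta> \<in> lower (forest_nodes \<zeta>)"
  have forest: "?P \<zeta>" if "\<And>t. t \<in># \<zeta> \<Longrightarrow> ?P {#t#}" for \<zeta>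
    using that
  proof (induction \<zeta>)
    case empty
    show ?case
      by (simp add: bas_empty_forest forest_op_one[OF g] lower_def subspace_0[OF subspace_free_span])
  next
    case (add t \<zeta>)
    then have "?P ({#t#} + \<zeta>)" by (intro forest_op_lower_mult[OF g]) auto
    then show ?case by simp
  qed
  have "?P {#t#}" for t
  proof (induction t)
    case (Node i \<zeta>)
    have "push (graft i) (forest_op g (bas \<zeta>) - bas \<zeta>) \<in> lower (Suc (forest_nodes \<zeta>))"
      by (rule lower_push_graft[OF forest[OF Node]])
    moreover have "g (bas (graft i \<zeta>)) *\<^sub>R (1 :: 'a forest \<Rightarrow>\<^sub>0 real) \<in> lower (Suc (forest_nodes \<zeta>))"
      unfolding lower_def bas_empty_forest[symmetric]
      by (intro subspace_scale subspace_free_span bas_in_free_span) (simp add: forest_nodes_def)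
    moreover have "forest_op g (bas (graft i \<zeta>)) - bas (graft i \<zeta>) =
        push (graft i) (forest_op g (bas \<zeta>) - bas \<zeta>) + g (bas (graft i \<zeta>)) *\<^sub>R 1"
      by (simp add: forest_op_graft linear_diff[OF linear_push])
    ultimately have "forest_op g (bas (graft i \<zeta>)) - bas (graft i \<zeta>) \<in> lower (Suc (forest_nodes \<zeta>))"
      unfolding lower_def by (simp only: subspace_add[OF subspace_free_span])
    then show ?case by (simp add: graft_def forest_nodes_def)
  qed
  then show ?thesis by (rule forest)
qed

section \<open>The structure group\<close>

lemma \<Gamma>_b_eq: "\<Gamma>_b g x = slice g (\<Delta>_b x)"
  by (simp add: \<Gamma>_b_def slice_def)

lemma linear_\<Gamma>_b: "linear (\<Gamma>_b g)"
  using linear_compose[OF linear_lin_ext linear_slice] by (simp add: o_def \<Gamma>_b_eq[abs_def] \<Delta>_b_def)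

abbreviation tree_symb :: "'d \<Rightarrow> 'd forest \<Rightarrow> 'd symb" where
  "tree_symb i \<zeta> \<equiv> Y (YTree (Node i \<zeta>))"

lemma symb_cases:
  obtains (one) "s = Y YOne" | (tree) i \<zeta> where "s = tree_symb i \<zeta>" | (noise) \<zeta> i where "s = Noise \<zeta> i"
  by (metis symb.exhaust ysym.exhaust tree.exhaust)

lemma \<Gamma>_b_Noise: "\<Gamma>_b g (bas (Noise \<zeta> i)) = push (\<lambda>\<eta>. Noise \<eta> i) (forest_op g (bas \<zeta>))"
  by (simp add: \<Gamma>_b_eq \<Delta>_b_def slice_push forest_op_def)

lemma inv_y_forest_empty: "inv y_forest {#} = YOne"
  and inv_y_forest_single: "inv y_forest {#t#} = YTree t"
  using inv_f_f[OF inj_y_forest, of YOne] inv_f_f[OF inj_y_forest, of "YTree t"] by simp_all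

lemma \<Gamma>_b_one: "g \<in> characters \<Longrightarrow> \<Gamma>_b g (bas (Y YOne)) = bas (Y YOne)"
  by (simp add: \<Gamma>_b_eq \<Delta>_b_def \<Delta>_star_one slice_bas inv_y_forest_empty)
     (simp add: bas_empty_forest character_one)

lemma \<Gamma>_b_tree:
  "\<Gamma>_b g (bas (tree_symb i \<zeta>)) =
     g (bas (graft i \<zeta>)) *\<^sub>R bas (Y YOne) + push (tree_symb i) (forest_op g (bas \<zeta>))"
proof -
  have "(\<lambda>\<eta>. Y (inv y_forest \<eta>)) \<circ> graft i = tree_symb i"
    by (auto simp: fun_eq_iff graft_def inv_y_forest_single)
  then show ?thesis
    using forest_op_graft[of g i \<zeta>]
    by (simp add: \<Gamma>_b_eq \<Delta>_b_def slice_push linear_add[OF linear_push] linear_scale[OF linear_push]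
        push_push inv_y_forest_empty flip: forest_op_def graft_def bas_empty_forest)
qed

lemma \<Gamma>_b_push_Noise:
  "\<Gamma>_b g (push (\<lambda>\<eta>. Noise \<eta> i) x) = push (\<lambda>\<eta>. Noise \<eta> i) (forest_op g x)"
proof (rule linear_eq_on_bas[where f = "\<lambda>x. \<Gamma>_b g (push (\<lambda>\<eta>. Noise \<eta> i) x)"])
  show "linear (\<lambda>x. \<Gamma>_b g (push (\<lambda>\<eta>. Noise \<eta> i) x))"
    using linear_compose[OF linear_push linear_\<Gamma>_b] by (simp add: o_def)
  show "linear (\<lambda>x. push (\<lambda>\<eta>. Noise \<eta> i) (forest_op g x))"
    using linear_compose[OF linear_forest_op linear_push] by (simp add: o_def)
qed (simp add: \<Gamma>_b_Noise)

lemma \<Gamma>_b_push_tree: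
  assumes "linear g"
  shows "\<Gamma>_b g (push (tree_symb i) x) =
     g (push (graft i) x) *\<^sub>R bas (Y YOne) + push (tree_symb i) (forest_op g x)"
proof (rule linear_eq_on_bas[where f = "\<lambda>x. \<Gamma>_b g (push (tree_symb i) x)"])
  show "linear (\<lambda>x. \<Gamma>_b g (push (tree_symb i) x))"
    using linear_compose[OF linear_push linear_\<Gamma>_b] by (simp add: o_def)
  show "linear (\<lambda>x. g (push (graft i) x) *\<^sub>R bas (Y YOne) + push (tree_symb i) (forest_op g x))"
    by (rule linearI)
       (simp_all add: linear_add[OF linear_push] linear_add[OF assms] linear_add[OF linear_forest_op]
         linear_scale[OF linear_push] linear_scale[OF assms] linear_scale[OF linear_forest_op]
         algebra_simps)
qed (simp add: \<Gamma>_b_tree)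

text \<open>
  For noise symbols this is \<open>forest_op_compose\<close> with \<open>\<Xi>\<^sub>i\<close> attached; for a tree the coefficients of \<open>1\<close>
  combine exactly as in the proof for forests.
\<close>

lemma \<Gamma>_b_compose:
  assumes g: "g \<in> characters" and h: "h \<in> characters"
  shows "\<Gamma>_b g \<circ> \<Gamma>_b h = \<Gamma>_b (g \<circ> forest_op h)"
proof
  have comp: "forest_op g (forest_op h x) = forest_op (g \<circ> forest_op h) x" for x
    using forest_op_compose[OF g h] by (simp add: fun_eq_iff)
  have lin: "linear g" by (rule character_linear[OF g])
  show "(\<Gamma>_b g \<circ> \<Gamma>_b h) x = \<Gamma>_b (g \<circ> forest_op h) x" for x
  proof (rule linear_eq_on_bas[OF linear_compose[OF linear_\<Gamma>_b linear_\<Gamma>_b] linear_\<Gamma>_b])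
    fix s :: "'a symb"
    show "(\<Gamma>_b g \<circ> \<Gamma>_b h) (bas s) = \<Gamma>_b (g \<circ> forest_op h) (bas s)"
    proof (cases s rule: symb_cases)
      case one
      then show ?thesis by (simp add: \<Gamma>_b_one g h character_forest_op)
    next
      case (tree i \<zeta>)
      then show ?thesis
        by (simp add: \<Gamma>_b_tree linear_add[OF linear_\<Gamma>_b] linear_scale[OF linear_\<Gamma>_b] \<Gamma>_b_one[OF g]
            \<Gamma>_b_push_tree[OF lin] comp forest_op_graft linear_add[OF lin] linear_scale[OF lin]
            character_one[OF g] scaleR_add_left)
    next
      case (noise \<zeta> i)
      then show ?thesis by (simp add: \<Gamma>_b_Noise \<Gamma>_b_push_Noise comp)
    qed
  qed
qed

lemma \<Gamma>_b_counit: "\<Gamma>_b counit = id"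
proof
  fix x :: "'a symb \<Rightarrow>\<^sub>0 real"
  show "\<Gamma>_b counit x = id x"
  proof (rule linear_eq_on_bas[OF linear_\<Gamma>_b linear_id])
    show "\<Gamma>_b counit (bas s) = id (bas s)" for s :: "'a symb"
      by (cases s rule: symb_cases)
         (simp_all add: \<Gamma>_b_one character_counit \<Gamma>_b_tree \<Gamma>_b_Noise counit_graft forest_op_counit)
  qed
qed

text \<open>
  Every element has a right inverse of the same form, and this right inverse has one as well;
  as in any monoid, the inverse is then two-sided.
\<close>

lemma \<Gamma>_b_inverse:
  assumes g: "g \<in> characters"
  shows "\<exists>h\<in>characters. \<Gamma>_b g \<circ> \<Gamma>_b h = id \<and> \<Gamma>_b h \<circ> \<Gamma>_b g = id"
proof -
  have right: "\<exists>h\<in>characters. \<Gamma>_b g \<circ> \<Gamma>_b h = id" if "g \<in> characters"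
    for g :: "('a forest \<Rightarrow>\<^sub>0 real) \<Rightarrow> real"
    using character_right_inverse[OF that] \<Gamma>_b_compose[OF that] \<Gamma>_b_counit by metis
  obtain h where h: "h \<in> characters" "\<Gamma>_b g \<circ> \<Gamma>_b h = id" using right[OF g] by blast
  obtain k where k: "k \<in> characters" "\<Gamma>_b h \<circ> \<Gamma>_b k = id" using right[OF h(1)] by blast
  have "\<Gamma>_b g = \<Gamma>_b g \<circ> (\<Gamma>_b h \<circ> \<Gamma>_b k)" by (simp add: k(2))
  also have "\<dots> = \<Gamma>_b k" by (simp add: h(2) flip: o_assoc[symmetric] comp_assoc)
  finally show ?thesis using h k by metis
qed

text \<open>
  The homogeneity of \<open>\<lfloor>\<zeta>\<rfloor>\<^sub>i\<close> and of \<open>\<zeta> \<Xi>\<^sub>i\<close> is strictly increasing in the number of nodes of \<open>\<zeta>\<close>, because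
  \<open>\<gamma> > 0\<close>. Loss of nodes in \<open>forest_op_lower\<close> is therefore loss of homogeneity.
  The extra multiple of \<open>1\<close> in the image of a tree has homogeneity \<open>0\<close>.
\<close>

lemma \<Gamma>_b_lower:
  assumes g: "g \<in> characters" and "0 < \<gamma>"
  shows "\<Gamma>_b g (bas s) - bas s \<in> free_span {s'. homogeneity \<gamma> s' < homogeneity \<gamma> s}"
proof (cases s rule: symb_cases)
  case one
  then show ?thesis by (simp add: \<Gamma>_b_one[OF g] subspace_0[OF subspace_free_span])
next
  case (tree i \<zeta>)
  let ?W = "free_span {s'. homogeneity \<gamma> s' < homogeneity \<gamma> s}"
  have "push (tree_symb i) (forest_op g (bas \<zeta>) - bas \<zeta>) \<in> ?W"
    by (rule push_in_free_span[OF forest_op_lower[OF g, unfolded lower_def]])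
       (use assms in \<open>auto simp: tree forest_nodes_graft[unfolded graft_def]\<close>)
  moreover have "g (bas (graft i \<zeta>)) *\<^sub>R bas (Y YOne) \<in> ?W"
    by (intro subspace_scale subspace_free_span bas_in_free_span)
       (use assms in \<open>simp add: tree forest_nodes_empty forest_nodes_graft[unfolded graft_def]\<close>)
  ultimately have "g (bas (graft i \<zeta>)) *\<^sub>R bas (Y YOne)
      + push (tree_symb i) (forest_op g (bas \<zeta>) - bas \<zeta>) \<in> ?W"
    by (intro subspace_add subspace_free_span)
  then show ?thesis
    by (simp add: tree \<Gamma>_b_tree linear_diff[OF linear_push] add_diff_eq)
next
  case (noise \<zeta> i)
  have "push (\<lambda>\<eta>. Noise \<eta> i) (forest_op g (bas \<zeta>) - bas \<zeta>) \<in>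
      free_span {s'. homogeneity \<gamma> s' < homogeneity \<gamma> s}"
    by (rule push_in_free_span[OF forest_op_lower[OF g, unfolded lower_def]])
       (use assms in \<open>auto simp: noise\<close>)
  then show ?thesis by (simp add: noise \<Gamma>_b_Noise linear_diff[OF linear_push])
qed

lemma \<Gamma>_b_Y_symbols: "g \<in> characters \<Longrightarrow> s \<in> Y_symbols \<Longrightarrow> \<Gamma>_b g (bas s) \<in> free_span Y_symbols"
  by (cases s rule: symb_cases)
     (auto simp: \<Gamma>_b_one \<Gamma>_b_tree Y_symbols_def free_span_iff_keys[of _ UNIV]
       intro!: subspace_add subspace_scale subspace_free_span bas_in_free_span
         push_in_free_span[where M = UNIV])

lemma \<Gamma>_b_Noise_symbols: "s \<in> Noise_symbols \<Longrightarrow> \<Gamma>_b g (bas s) \<in> free_span Noise_symbols"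
  by (auto simp: \<Gamma>_b_Noise Noise_symbols_def free_span_iff_keys[of _ UNIV]
       intro!: push_in_free_span[where M = UNIV])

section \<open>The grading by homogeneity\<close>

lemma finite_bounded_multisets:
  assumes "finite S"
  shows "finite {M. set_mset M \<subseteq> S \<and> size M \<le> n}"
proof -
  have "{M. set_mset M \<subseteq> S \<and> size M \<le> n} = (\<Union>k\<le>n. multisets_of_size S k)"
    by (auto simp: multisets_of_size_def)
  then show ?thesis using finite_multisets_of_size[OF assms] by simp
qed

lemma tree_nodes_pos: "0 < tree_nodes t"
  by (cases t) simp

lemma size_le_forest_nodes: "size \<zeta> \<le> forest_nodes \<zeta>"
proof (induction \<zeta>)
  case (add t \<zeta>)
  then show ?case using tree_nodes_pos[of t] by (simp add: forest_nodes_def)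
qed (simp add: forest_nodes_def)

lemma tree_nodes_le_forest_nodes: "t \<in># \<zeta> \<Longrightarrow> tree_nodes t \<le> forest_nodes \<zeta>"
  by (metis forest_nodes_def image_mset_add_mset insert_DiffM le_add1 sum_mset.insert)

text \<open>
  With finitely many labels, a bound on the number of nodes of a forest bounds the number of its
  trees and the size of each tree, and a tree with at most \<open>n + 1\<close> nodes is a label and a forest with at
  most \<open>n\<close> nodes.
\<close>

lemma finite_forests: "finite {\<zeta> :: 'd::finite forest. forest_nodes \<zeta> \<le> n}"
  and finite_trees: "finite {t :: 'd::finite tree. tree_nodes t \<le> n}"
proof -
  have forests: "finite {\<zeta> :: 'd forest. forest_nodes \<zeta> \<le> n}"
    if "finite {t :: 'd tree. tree_nodes t \<le> n}" for n
    by (rule finite_subset[OF _ finite_bounded_multisets[OF that, of n]])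
       (use size_le_forest_nodes tree_nodes_le_forest_nodes in \<open>auto intro: order_trans\<close>)
  have trees: "finite {t :: 'd tree. tree_nodes t \<le> n}" for n
  proof (induction n)
    case 0
    have none: "{t :: 'd tree. tree_nodes t \<le> 0} = {}" using tree_nodes_pos by auto
    show ?case by (simp only: none finite.emptyI)
  next
    case (Suc n)
    have "{t :: 'd tree. tree_nodes t \<le> Suc n} \<subseteq>
        (\<lambda>(i, \<zeta>). Node i \<zeta>) ` (UNIV \<times> {\<zeta>. forest_nodes \<zeta> \<le> n})"
    proof
      fix t :: "'d tree" assume "t \<in> {t. tree_nodes t \<le> Suc n}"
      then show "t \<in> (\<lambda>(i, \<zeta>). Node i \<zeta>) ` (UNIV \<times> {\<zeta>. forest_nodes \<zeta> \<le> n})"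
        by (cases t) (auto simp: forest_nodes_def)
    qed
    then show ?case using forests[OF Suc] by (auto intro: finite_subset)
  qed
  show "finite {t :: 'd tree. tree_nodes t \<le> n}" by (rule trees)
  then show "finite {\<zeta> :: 'd forest. forest_nodes \<zeta> \<le> n}" by (rule forests)
qed

lemma finite_homogeneity_below:
  assumes "0 < \<gamma>"
  shows "finite {s :: 'd::finite symb. homogeneity \<gamma> s < r}"
proof -
  obtain n where n: "(r + 1) / \<gamma> < real n" using reals_Archimedean2 by blast
  have bound: "m \<le> n" if "\<gamma> * real m < r + 1" for m
  proof -
    have "real m < (r + 1) / \<gamma>" using that assms by (simp add: field_simps)
    then show ?thesis using n by linarith
  qed
  let ?B = "insert (Y YOne) ((\<lambda>t. Y (YTree t)) ` {t :: 'd tree. tree_nodes t \<le> n}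
      \<union> (\<lambda>(\<zeta>, i). Noise \<zeta> i) ` ({\<zeta>. forest_nodes \<zeta> \<le> n} \<times> UNIV))"
  have "s \<in> ?B" if "homogeneity \<gamma> s < r" for s
  proof (cases s)
    case (Y \<tau>)
    then show ?thesis using that bound by (cases \<tau>) (auto simp: forest_nodes_def)
  next
    case (Noise \<zeta> i)
    then have "forest_nodes \<zeta> \<le> n" using that bound assms by simp
    with Noise show ?thesis by auto
  qed
  then have "{s. homogeneity \<gamma> s < r} \<subseteq> ?B" by auto
  moreover have "finite ?B" by (intro finite.insertI finite_UnI finite_imageI finite_trees
        finite_cartesian_product finite_forests finite)
  ultimately show ?thesis by (rule finite_subset)
qed

lemma homogeneity_in_A_b: "homogeneity \<gamma> s \<in> A_b \<gamma>"
proof (cases s)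
  case (Noise \<zeta> i)
  have "homogeneity \<gamma> s = \<gamma> * real (Suc (forest_nodes \<zeta>)) - 1"
    by (simp add: Noise algebra_simps)
  moreover have "1 \<le> Suc (forest_nodes \<zeta>)" by simp
  ultimately show ?thesis unfolding A_b_def by blast
qed (auto simp: A_b_def)

lemma homogeneity_onto_A_b:
  assumes "\<alpha> \<in> A_b \<gamma>"
  shows "\<exists>s :: 'd symb. homogeneity \<gamma> s = \<alpha>"
proof -
  have tau: "\<exists>\<tau> :: 'd ysym. forest_nodes (y_forest \<tau>) = n" for n
  proof (cases n)
    case 0
    then show ?thesis by (intro exI[of _ YOne]) (simp add: forest_nodes_def)
  next
    case (Suc m)
    obtain t :: "'d tree" where "tree_nodes t = Suc m" using ex_tree_nodes by blast
    then show ?thesis by (intro exI[of _ "YTree t"]) (simp add: Suc forest_nodes_def)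
  qed
  consider n where "\<alpha> = \<gamma> * real n" | n where "n \<ge> 1" "\<alpha> = \<gamma> * real n - 1"
    using assms unfolding A_b_def by blast
  then show ?thesis
  proof cases
    case 1
    obtain \<tau> :: "'d ysym" where "forest_nodes (y_forest \<tau>) = n" using tau by blast
    then show ?thesis by (intro exI[of _ "Y \<tau>"]) (simp add: 1)
  next
    case 2
    obtain \<tau> :: "'d ysym" where "forest_nodes (y_forest \<tau>) = n - 1" using tau by blast
    then show ?thesis
      using 2 by (intro exI[of _ "Noise (y_forest \<tau>) undefined"]) (simp add: of_nat_diff algebra_simps)
  qed
qed

lemma A_b_bdd_below: "0 < \<gamma> \<Longrightarrow> bdd_below (A_b \<gamma>)"
  by (rule bdd_belowI[of _ "-1"]) (auto simp: A_b_def intro: order_trans[of _ 0])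

lemma A_b_locally_finite:
  assumes "0 < \<gamma>"
  shows "finite (A_b \<gamma> \<inter> {..<r})"
proof -
  \<comment> \<open>Every label type leads to the same homogeneities, so one label suffices for counting them.\<close>
  have "A_b \<gamma> \<inter> {..<r} \<subseteq> homogeneity \<gamma> ` {s :: unit symb. homogeneity \<gamma> s < r}"
  proof
    fix \<alpha> assume \<alpha>: "\<alpha> \<in> A_b \<gamma> \<inter> {..<r}"
    obtain s :: "unit symb" where "homogeneity \<gamma> s = \<alpha>" using homogeneity_onto_A_b \<alpha> by blast
    with \<alpha> show "\<alpha> \<in> homogeneity \<gamma> ` {s :: unit symb. homogeneity \<gamma> s < r}" by auto
  qed
  then show ?thesis using finite_homogeneity_below[OF assms] finite_subset by blast
qed

section \<open>The regularity structure and its sectors\<close>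

theorem theorem5p17:
  fixes \<gamma> :: real
  assumes "0 < \<gamma>" and "\<gamma> < 1"
  shows "regularity_structure (A_b \<gamma>) (T_b \<gamma> :: real \<Rightarrow> ('d::finite symb \<Rightarrow>\<^sub>0 real) set)
           (\<lambda>_. euclidean_norm) (\<Gamma>_b ` characters)
       \<and> sector (A_b \<gamma>) (T_b \<gamma> :: real \<Rightarrow> ('d symb \<Rightarrow>\<^sub>0 real) set)
           (\<lambda>_. euclidean_norm) (\<Gamma>_b ` characters) (free_span Y_symbols)
       \<and> sector (A_b \<gamma>) (T_b \<gamma> :: real \<Rightarrow> ('d symb \<Rightarrow>\<^sub>0 real) set)
           (\<lambda>_. euclidean_norm) (\<Gamma>_b ` characters) (free_span Noise_symbols)"
proof -
  interpret graded_basis "A_b \<gamma>" "homogeneity \<gamma> :: 'd symb \<Rightarrow> real"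
    by unfold_locales (simp_all add: homogeneity_in_A_b finite_homogeneity_below assms(1))
  have T: "T_b \<gamma> = (T :: real \<Rightarrow> ('d symb \<Rightarrow>\<^sub>0 real) set)"
    by (simp add: fun_eq_iff T_b_def T_def)
  have "regularity_structure (A_b \<gamma>) T (\<lambda>_. euclidean_norm) (\<Gamma>_b ` characters)"
  proof (rule regularity_structure.intro)
    show "bdd_below (A_b \<gamma>)" "\<And>r. finite (A_b \<gamma> \<inter> {..<r})"
      using A_b_bdd_below A_b_locally_finite assms(1) by auto
    show "banach_on (T \<alpha>) euclidean_norm" for \<alpha> by (rule banach_on_T)
    show "T \<alpha> \<noteq> {0}" if \<alpha>: "\<alpha> \<in> A_b \<gamma>" for \<alpha>
    proof -
      obtain s :: "'d symb" where "homogeneity \<gamma> s = \<alpha>" using homogeneity_onto_A_b[OF \<alpha>] by blast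
      then have "bas s \<in> T \<alpha>" by (simp add: T_def bas_in_free_span)
      then show ?thesis using bas_nonzero[of s] by auto
    qed
    show "\<exists>!f. graded_decomp (A_b \<gamma>) T x f" for x by (simp add: graded_decomp_iff)
    show "id \<in> \<Gamma>_b ` characters" using \<Gamma>_b_counit character_counit by (metis imageI)
    fix \<Gamma> :: "('d symb \<Rightarrow>\<^sub>0 real) \<Rightarrow> ('d symb \<Rightarrow>\<^sub>0 real)" assume "\<Gamma> \<in> \<Gamma>_b ` characters"
    then obtain g where g: "g \<in> characters" "\<Gamma> = \<Gamma>_b g" by blast
    show lin: "linear \<Gamma>" by (simp add: g linear_\<Gamma>_b)
    obtain h where h: "h \<in> characters" "\<Gamma> \<circ> \<Gamma>_b h = id" "\<Gamma>_b h \<circ> \<Gamma> = id"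
      using \<Gamma>_b_inverse[OF g(1)] g(2) by blast
    show "bij \<Gamma>" using h(2,3) by (rule o_bij[rotated])
    have "inv \<Gamma> = \<Gamma>_b h" using h(2,3) by (metis inv_unique_comp)
    then show "inv \<Gamma> \<in> \<Gamma>_b ` characters" using h(1) by simp
    have tri: "\<Gamma> (bas s) - bas s \<in> free_span {s'. homogeneity \<gamma> s' < homogeneity \<gamma> s}" for s
      using \<Gamma>_b_lower[OF g(1) assms(1)] by (simp add: g(2))
    show "continuous_in_norm (graded_norm (A_b \<gamma>) T (\<lambda>_. euclidean_norm)) (graded_below (A_b \<gamma>) T r) \<Gamma>"
      for r by (rule continuous_on_below[OF lin tri])
    show "\<Gamma> x - x \<in> graded_below (A_b \<gamma>) T \<alpha>" if "x \<in> T \<alpha>" for \<alpha> x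
      by (rule triangular_on_T[OF lin tri that])
    fix \<Gamma>' :: "('d symb \<Rightarrow>\<^sub>0 real) \<Rightarrow> ('d symb \<Rightarrow>\<^sub>0 real)" assume "\<Gamma>' \<in> \<Gamma>_b ` characters"
    then show "\<Gamma> \<circ> \<Gamma>' \<in> \<Gamma>_b ` characters"
      using \<Gamma>_b_compose[OF g(1)] character_forest_op[OF g(1)] g(2) by auto
  qed
  moreover have "sector (A_b \<gamma>) T (\<lambda>_. euclidean_norm) (\<Gamma>_b ` characters) (free_span Y_symbols)"
    by (rule sector_free_span) (auto simp: linear_\<Gamma>_b \<Gamma>_b_Y_symbols)
  moreover have "sector (A_b \<gamma>) T (\<lambda>_. euclidean_norm) (\<Gamma>_b ` characters) (free_span Noise_symbols)"
    by (rule sector_free_span) (auto simp: linear_\<Gamma>_b \<Gamma>_b_Noise_symbols)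
  ultimately show ?thesis by (simp only: T)
qed

end
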